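(* Let $\mathfrak g$ be a quasi-triangular Lie bialgebra with a family $\mathbf r=\{r^{(c)}\}_{c\in C}\subset\mathfrak g\otimes\mathfrak g$ of classical r-matrices corresponding to the same Lie cobracket on $\mathfrak g$. Let $n\ge 1$, let $\boldsymbol d=(d_1,\dots,d_n)\in C^n$ and let $\mathbf c=(c_{i,j})_{1\le i<j\le n}$ be a transitive $n$-array with entries in $C$. Set $$\mathbf r(\mathbf c,\boldsymbol d)=\sum_{1\le i\le n}(r^{(d_i)})_{i,i+n}+\sum_{1\le i<j\le n}\Big((r^{(c_{i,j})})_{j,i+n}-(r^{(c_{i,j})})_{j+n,i}\Big)\in\mathfrak g^{\oplus n}\otimes\mathfrak g^{\oplus n}.$$ Then $\mathfrak g^{\oplus n}$ is a quasi-triangular Lie bialgebra with the r-matrix $\mathbf r(\mathbf c,\boldsymbol d)$; that is, the map $\tilde\delta_{\mathbf c}:\mathfrak g^{\oplus n}\to\mathfrak g^{\oplus n}\otimes\mathfrak g^{\oplus n}$ defined by $\tilde\delta_{\mathbf c}(x)=[\mathbf r(\mathbf c,\boldsymbol d),1\otimes x+x\otimes 1]$, $x\in\mathfrak g^{\oplus n}$, is a Lie cobracket and $\mathbf r(\mathbf c,\boldsymbol d)$ solves the classical Yang-Baxter equation.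
   Context: The base field $\Bbbk$ has characteristic zero. For a Lie algebra $\mathfrak l$, $\Delta:U(\mathfrak l)\to U(\mathfrak l)\otimes U(\mathfrak l)$ is the standard comultiplication ($\Delta(x)=x\otimes 1+1\otimes x$ for $x\in\mathfrak l$), and $\mathfrak l\otimes\mathfrak l\subset U(\mathfrak l)\otimes U(\mathfrak l)$; $\tau_{i,j}$ denotes the swap of the $i$-th and $j$-th tensor factors. Leg notation: for $x=\sum_t a_t\otimes b_t\in\mathfrak l\otimes\mathfrak l$ and distinct $i,j\in\{1,\dots,m\}$, $x_{i,j}\in U(\mathfrak l)^{\otimes m}$ is the element $\sum_t$ of the tensors with $a_t$ in position $i$, $b_t$ in position $j$ and $1$ elsewhere (both $i<j$ and $i>j$ allowed). A Lie cobracket on $\mathfrak l$ is a linear map $\delta:\mathfrak l\to\mathfrak l\otimes\mathfrak l$ with (1) $\delta([x,y])=[\delta(x),\Delta(y)]-[\delta(y),\Delta(x)]$ in $U(\mathfrak l)^{\otimes 2}$ for all $x,y\in\mathfrak l$; (2) $\tau_{1,2}\circ\delta=-\delta$; (3) $(\mathrm{id}+\tau_{1,2}\tau_{2,3}+\tau_{2,3}\tau_{1,2})\circ(\delta\otimes\mathrm{id})\circ\delta=0$. A Lie bialgebra is a Lie algebra with a Lie cobracket. For $r\in\mathfrak l\otimes\mathfrak l$ put $\delta_r(x)=[r,\Delta(x)]$, $x\in\mathfrak l$. The classical Yang-Baxter equation (CYBE) for $r$ is $[r_{1,2},r_{1,3}]+[r_{1,2},r_{2,3}]+[r_{1,3},r_{2,3}]=0$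 in $U(\mathfrak l)^{\otimes 3}$. A Lie bialgebra $(\mathfrak l,\delta)$ is quasi-triangular with (classical) r-matrix $r$ if $\delta=\delta_r$ and $r$ solves the CYBE. A family $\{r^{(c)}\}_{c\in C}$ of r-matrices corresponds to the same cobracket if each $r^{(c)}$ is an r-matrix for one and the same $(\mathfrak l,\delta)$. $U(\mathfrak g^{\oplus n})$ is identified with $U(\mathfrak g)^{\otimes n}$, so $\mathfrak g^{\oplus n}\otimes\mathfrak g^{\oplus n}\subset U(\mathfrak g)^{\otimes 2n}$, the first $n$ positions corresponding to the first factor $\mathfrak g^{\oplus n}$ and the last $n$ to the second. An array $\mathbf c=(c_{i,j})_{1\le i<j\le n}$ with entries in a set $C$ is transitive if $c_{i,k}\in\{c_{i,j},c_{j,k}\}$ for all $1\le i<j<k\le n$. *)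

theory Defs
  imports
    Complex_Main
    "HOL-Library.Poly_Mapping"
    "HOL-Library.Function_Algebras"
    "HOL-Library.Numeral_Type"
    "HOL-Combinatorics.Transposition"
begin

section \<open>Lie algebras\<close>

locale lie_algebra = vector_space scale
  for scale :: "'k::field \<Rightarrow> 'a::ab_group_add \<Rightarrow> 'a" +
  fixes bracket :: "'a \<Rightarrow> 'a \<Rightarrow> 'a"
  assumes bracket_add_left: "bracket (x + y) z = bracket x z + bracket y z"
    and bracket_add_right: "bracket x (y + z) = bracket x y + bracket x z"
    and bracket_scale_left: "bracket (scale a x) y = scale a (bracket x y)"
    and bracket_scale_right: "bracket x (scale a y) = scale a (bracket x y)"
    and bracket_self: "bracket x x = 0"
    and jacobi: "bracket x (bracket y z) + bracket y (bracket z x) + bracket z (bracket x y) = 0"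

text \<open>The direct sum of copies of a Lie algebra indexed by \<open>'n\<close>, on the functions \<open>'n \<Rightarrow> 'a\<close>.\<close>

definition sum_scale :: "('k \<Rightarrow> 'a \<Rightarrow> 'a) \<Rightarrow> 'k \<Rightarrow> ('n \<Rightarrow> 'a) \<Rightarrow> ('n \<Rightarrow> 'a)" where
  "sum_scale scale a x = (\<lambda>i. scale a (x i))"

definition sum_bracket :: "('a \<Rightarrow> 'a \<Rightarrow> 'a) \<Rightarrow> ('n \<Rightarrow> 'a) \<Rightarrow> ('n \<Rightarrow> 'a) \<Rightarrow> ('n \<Rightarrow> 'a)" where
  "sum_bracket bracket x y = (\<lambda>i. bracket (x i) (y i))"


section \<open>Free algebras and their tensor powers\<close>

text \<open>Words under concatenation form the free monoid on \<open>'a\<close>.  It is written additively because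
  the convolution product of \<^typ>\<open>'b \<Rightarrow>\<^sub>0 'k\<close> is defined for additive monoids of exponents.\<close>

datatype 'a word = Word (letters: "'a list")

instantiation word :: (type) monoid_add
begin

definition zero_word :: "'a word" where
  "zero_word = Word []"

definition plus_word :: "'a word \<Rightarrow> 'a word \<Rightarrow> 'a word" where
  "plus_word u v = Word (letters u @ letters v)"

instance
  by standard (simp_all add: zero_word_def plus_word_def)

end

text \<open>The free associative algebra on the set \<open>'a\<close> is the monoid algebra of \<open>'a word\<close>.
  Its tensor power with factors indexed by the finite type \<open>'i\<close> is the monoid algebra of
  \<open>'i \<Rightarrow> 'a word\<close>: the family \<open>w\<close> stands for the pure tensor with \<open>w i\<close> in position \<open>i\<close>,
  multiplication is performed factorwise, and words in different positions commute.\<close>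

type_synonym ('a, 'k) free_algebra = "'a word \<Rightarrow>\<^sub>0 'k"
type_synonym ('i, 'a, 'k) free_tensor = "('i \<Rightarrow> 'a word) \<Rightarrow>\<^sub>0 'k"

definition scalar :: "'k::zero \<Rightarrow> 'm::zero \<Rightarrow>\<^sub>0 'k" where
  "scalar a = Poly_Mapping.single 0 a"

text \<open>The linear map induced by a map \<open>f\<close> of basis elements.\<close>

definition linear_ext :: "('m \<Rightarrow> 'm') \<Rightarrow> ('m \<Rightarrow>\<^sub>0 'k::comm_monoid_add) \<Rightarrow> ('m' \<Rightarrow>\<^sub>0 'k)" where
  "linear_ext f p = (\<Sum>w\<in>Poly_Mapping.keys p. Poly_Mapping.single (f w) (Poly_Mapping.lookup p w))"

definition letter :: "'a \<Rightarrow> ('a, 'k::zero_neq_one) free_algebra" where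
  "letter x = Poly_Mapping.single (Word [x]) 1"

text \<open>\<open>slot i u\<close> is the tensor with \<open>u\<close> in position \<open>i\<close> and \<open>1\<close> elsewhere.\<close>

definition slot :: "'i \<Rightarrow> ('a, 'k::comm_monoid_add) free_algebra \<Rightarrow> ('i, 'a, 'k) free_tensor" where
  "slot i = linear_ext (\<lambda>w k. if k = i then w else 0)"

definition commutator :: "'r::ring \<Rightarrow> 'r \<Rightarrow> 'r" where
  "commutator p q = p * q - q * p"


section \<open>Universal enveloping algebras and their tensor powers\<close>

inductive_set two_sided_ideal :: "'r::ring_1 set \<Rightarrow> 'r set" for S where
  ideal_gen: "s \<in> S \<Longrightarrow> s \<in> two_sided_ideal S"
| ideal_zero: "0 \<in> two_sided_ideal S"
| ideal_add: "p \<in> two_sided_ideal S \<Longrightarrow> q \<in> two_sided_ideal S \<Longrightarrow> p + q \<in> two_sided_ideal S"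
| ideal_mult: "p \<in> two_sided_ideal S \<Longrightarrow> u * p * v \<in> two_sided_ideal S"

text \<open>\<open>U(l)\<close> is the free algebra on the set \<open>l\<close> modulo the two-sided ideal generated by the
  relations below, which make \<open>x \<mapsto> letter x\<close> linear and a homomorphism of Lie algebras.\<close>

definition envelope_relations ::
    "('k::field \<Rightarrow> 'a::ab_group_add \<Rightarrow> 'a) \<Rightarrow> ('a \<Rightarrow> 'a \<Rightarrow> 'a) \<Rightarrow> ('a, 'k) free_algebra set" where
  "envelope_relations scale bracket =
     {letter (x + y) - (letter x + letter y) | x y. True}
   \<union> {letter (scale a x) - scalar a * letter x | a x. True}
   \<union> {commutator (letter x) (letter y) - letter (bracket x y) | x y. True}"

text \<open>A tensor product of quotient algebras \<open>A\<^sub>i / J\<^sub>i\<close> is the quotient of the tensor product of the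
  \<open>A\<^sub>i\<close> by the ideal generated by the \<open>J\<^sub>i\<close> placed in position \<open>i\<close>.  Elements of the tensor power
  of \<open>U(l)\<close> with positions \<open>'i\<close> are given by representatives in \<open>('i, 'a, 'k) free_tensor\<close>;
  equality in the tensor power is the following congruence.\<close>

definition U_eq ::
    "('k::field \<Rightarrow> 'a::ab_group_add \<Rightarrow> 'a) \<Rightarrow> ('a \<Rightarrow> 'a \<Rightarrow> 'a) \<Rightarrow>
     ('i, 'a, 'k) free_tensor \<Rightarrow> ('i, 'a, 'k) free_tensor \<Rightarrow> bool" where
  "U_eq scale bracket p q \<longleftrightarrow>
     p - q \<in> two_sided_ideal (\<Union>i. slot i ` envelope_relations scale bracket)"


section \<open>Tensor operations\<close>

text \<open>The types \<open>2\<close> and \<open>3\<close> index the positions of tensor squares and cubes.  Their elements are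
  \<open>1, 2\<close> and \<open>1, 2, 3\<close> respectively, as \<open>2 = 0\<close> in the type \<open>2\<close> and \<open>3 = 0\<close> in the type \<open>3\<close>.\<close>

text \<open>The sum of the pure tensors \<open>a \<otimes> b\<close> over the pairs \<open>(a, b)\<close> of a list.\<close>

definition tensor_sum :: "('a \<times> 'a) list \<Rightarrow> (2, 'a, 'k::field) free_tensor" where
  "tensor_sum ts = (\<Sum>(a, b)\<leftarrow>ts. slot 1 (letter a) * slot 2 (letter b))"

text \<open>Membership in the subspace \<open>l \<otimes> l\<close> of \<open>U(l) \<otimes> U(l)\<close>; scalar coefficients are
  absorbed in the first factor.\<close>

definition in_lie_tensor ::
    "('k::field \<Rightarrow> 'a::ab_group_add \<Rightarrow> 'a) \<Rightarrow> ('a \<Rightarrow> 'a \<Rightarrow> 'a) \<Rightarrow> (2, 'a, 'k) free_tensor \<Rightarrow> bool" where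
  "in_lie_tensor scale bracket p \<longleftrightarrow> (\<exists>ts. U_eq scale bracket p (tensor_sum ts))"

text \<open>Comultiplication on the elements of \<open>l\<close>: \<open>x \<otimes> 1 + 1 \<otimes> x\<close>.\<close>

definition comult :: "'a \<Rightarrow> (2, 'a, 'k::field) free_tensor" where
  "comult x = slot 1 (letter x) + slot 2 (letter x)"

text \<open>Leg notation, for distinct \<open>i\<close> and \<open>j\<close>: the first tensor factor is moved to position \<open>i\<close>,
  the second one to position \<open>j\<close>, and the remaining positions are filled with \<open>1\<close>.\<close>

definition leg :: "'i \<Rightarrow> 'i \<Rightarrow> (2, 'a, 'k::comm_monoid_add) free_tensor \<Rightarrow> ('i, 'a, 'k) free_tensor" where
  "leg i j = linear_ext (\<lambda>w k. if k = i then w 1 else if k = j then w 2 else 0)"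

definition swap :: "'i \<Rightarrow> 'i \<Rightarrow> ('i, 'a, 'k::comm_monoid_add) free_tensor \<Rightarrow> ('i, 'a, 'k) free_tensor" where
  "swap i j = linear_ext (\<lambda>w k. w (Transposition.transpose i j k))"


section \<open>Lie bialgebras\<close>

text \<open>\<open>\<delta> \<otimes> id\<close> applied to \<open>tensor_sum ts\<close>.\<close>

definition cobracket_id ::
    "('a \<Rightarrow> (2, 'a, 'k::field) free_tensor) \<Rightarrow> ('a \<times> 'a) list \<Rightarrow> (3, 'a, 'k) free_tensor" where
  "cobracket_id \<delta> ts = (\<Sum>(a, b)\<leftarrow>ts. leg 1 2 (\<delta> a) * slot 3 (letter b))"

text \<open>In the co-Jacobi identity, \<open>\<delta> x\<close> has to be written as a sum of pure tensors before
  \<open>\<delta> \<otimes> id\<close> can be applied.  Such an expression exists by the first condition, and, \<open>\<delta>\<close> being linear,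
  the element \<open>(\<delta> \<otimes> id) (\<delta> x)\<close> does not depend on the choice.\<close>

definition lie_cobracket ::
    "('k::field \<Rightarrow> 'a::ab_group_add \<Rightarrow> 'a) \<Rightarrow> ('a \<Rightarrow> 'a \<Rightarrow> 'a) \<Rightarrow>
     ('a \<Rightarrow> (2, 'a, 'k) free_tensor) \<Rightarrow> bool" where
  "lie_cobracket scale bracket \<delta> \<longleftrightarrow>
     (\<forall>x. in_lie_tensor scale bracket (\<delta> x)) \<and>
     (\<forall>x y. U_eq scale bracket (\<delta> (x + y)) (\<delta> x + \<delta> y)) \<and>
     (\<forall>a x. U_eq scale bracket (\<delta> (scale a x)) (scalar a * \<delta> x)) \<and>
     (\<forall>x y. U_eq scale bracket (\<delta> (bracket x y))
              (commutator (\<delta> x) (comult y) - commutator (\<delta> y) (comult x))) \<and>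
     (\<forall>x. U_eq scale bracket (swap 1 2 (\<delta> x)) (- \<delta> x)) \<and>
     (\<forall>x ts. U_eq scale bracket (\<delta> x) (tensor_sum ts) \<longrightarrow>
        (let t = cobracket_id \<delta> ts
         in U_eq scale bracket (t + swap 1 2 (swap 2 3 t) + swap 2 3 (swap 1 2 t)) 0))"

definition lie_bialgebra ::
    "('k::field \<Rightarrow> 'a::ab_group_add \<Rightarrow> 'a) \<Rightarrow> ('a \<Rightarrow> 'a \<Rightarrow> 'a) \<Rightarrow>
     ('a \<Rightarrow> (2, 'a, 'k) free_tensor) \<Rightarrow> bool" where
  "lie_bialgebra scale bracket \<delta> \<longleftrightarrow> lie_algebra scale bracket \<and> lie_cobracket scale bracket \<delta>"

text \<open>The map \<open>\<delta>\<^sub>r\<close>.\<close>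

definition coboundary :: "(2, 'a, 'k::field) free_tensor \<Rightarrow> 'a \<Rightarrow> (2, 'a, 'k) free_tensor" where
  "coboundary r x = commutator r (comult x)"

definition CYBE ::
    "('k::field \<Rightarrow> 'a::ab_group_add \<Rightarrow> 'a) \<Rightarrow> ('a \<Rightarrow> 'a \<Rightarrow> 'a) \<Rightarrow> (2, 'a, 'k) free_tensor \<Rightarrow> bool" where
  "CYBE scale bracket r \<longleftrightarrow>
     U_eq scale bracket
       (commutator (leg (1::3) 2 r) (leg 1 3 r)
        + commutator (leg 1 2 r) (leg 2 3 r)
        + commutator (leg 1 3 r) (leg 2 3 r)) 0"

definition quasi_triangular ::
    "('k::field \<Rightarrow> 'a::ab_group_add \<Rightarrow> 'a) \<Rightarrow> ('a \<Rightarrow> 'a \<Rightarrow> 'a) \<Rightarrow>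
     ('a \<Rightarrow> (2, 'a, 'k) free_tensor) \<Rightarrow> (2, 'a, 'k) free_tensor \<Rightarrow> bool" where
  "quasi_triangular scale bracket \<delta> r \<longleftrightarrow>
     lie_bialgebra scale bracket \<delta> \<and>
     in_lie_tensor scale bracket r \<and>
     (\<forall>x. U_eq scale bracket (\<delta> x) (coboundary r x)) \<and>
     CYBE scale bracket r"


section \<open>The r-matrix of a transitive array\<close>

definition transitive_array :: "('n::linorder \<Rightarrow> 'n \<Rightarrow> 'c) \<Rightarrow> bool" where
  "transitive_array c \<longleftrightarrow> (\<forall>i j k. i < j \<longrightarrow> j < k \<longrightarrow> c i k \<in> {c i j, c j k})"

text \<open>The index set \<open>{1, \<dots>, n}\<close> is the finite linearly ordered type \<open>'n\<close>, and the \<open>2n\<close> positions are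
  \<open>'n + 'n\<close>, where \<open>Inl i\<close> is position \<open>i\<close> and \<open>Inr i\<close> is position \<open>i + n\<close>.

  The map below is the identification of the tensor power of \<open>U(g)\<close> with these positions with the
  tensor square of \<open>U(g\<^sup>n)\<close>.  A word in the \<open>i\<close>-th position of the first (second) half becomes a
  word in the \<open>i\<close>-th summand of \<open>g\<^sup>n\<close> in the first (second) factor.  Elements of distinct summands
  commute in \<open>U(g\<^sup>n)\<close>; the increasing order in which their words are multiplied only
  affects the representative.\<close>

definition summand_word :: "'n \<Rightarrow> 'a::zero word \<Rightarrow> ('n \<Rightarrow> 'a) word" where
  "summand_word i = map_word (\<lambda>x. (\<lambda>_. 0)(i := x))"

definition merge_words :: "('n::{finite,linorder} \<Rightarrow> 'a::zero word) \<Rightarrow> ('n \<Rightarrow> 'a) word" where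
  "merge_words w = (\<Sum>i\<leftarrow>sorted_list_of_set UNIV. summand_word i (w i))"

definition identify ::
    "('n::{finite,linorder} + 'n, 'a::zero, 'k::comm_monoid_add) free_tensor \<Rightarrow>
     (2, 'n \<Rightarrow> 'a, 'k) free_tensor" where
  "identify = linear_ext (\<lambda>w k. if k = 1 then merge_words (w \<circ> Inl) else merge_words (w \<circ> Inr))"

definition array_r_matrix ::
    "('c \<Rightarrow> (2, 'a::zero, 'k::field) free_tensor) \<Rightarrow>
     ('n::{finite,linorder} \<Rightarrow> 'n \<Rightarrow> 'c) \<Rightarrow> ('n \<Rightarrow> 'c) \<Rightarrow> (2, 'n \<Rightarrow> 'a, 'k) free_tensor" where
  "array_r_matrix r c d = identify
     ((\<Sum>i\<in>UNIV. leg (Inl i) (Inr i) (r (d i)))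
      + (\<Sum>(i, j)\<in>{(i, j). i < j}.
           leg (Inl j) (Inr i) (r (c i j)) - leg (Inr j) (Inl i) (r (c i j))))"

end

(* The components R_ab of the r-matrix in g_a (x) g_b are r-matrices of (g, delta): this class is
   closed under r |-> -tau(r) because delta is skew.  The CYBE splits into the components
   [A_12, B_13] + [A_12, C_23] + [B_13, C_23] = 0 with A = R_ij, B = R_ik, C = R_jk.  Two r-matrices
   of the same cobracket differ by an ad-invariant tensor, and an ad-invariant S satisfies
   [S_12, T_13 + T_23] = 0 for every T in g (x) g.  Hence, as soon as A = B, B = C or C = -tau(A),
   the remaining r-matrix may be replaced by the repeated one and the equation becomes the CYBE of
   a single r-matrix.  Transitivity of the array, together with R_ba = -tau(R_ab) for distinct a, b,
   implies that one of the three coincidences always occurs.  The symmetric part of the whole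
   r-matrix is the sum of those of the diagonal components, hence invariant; together with the CYBE
   this makes its coboundary a Lie cobracket. *)

theory Submission
  imports Defs
begin

section \<open>Linear maps induced by maps of basis elements\<close>

text \<open>The induction offers the representatives 0 and 1, and 0 is the numeral 2 in the type
  \<open>2\<close>.\<close>

lemma exhaust_index2: "(k::2) = 1 \<or> k = 2"
proof (induct k)
  case (of_int z)
  then have "z = 0 \<or> z = 1" by auto
  then show ?case by auto
qed

text \<open>Terms outside the support vanish. A common index set is wanted because cancellation can
  shrink the support of a sum.\<close>

lemma linear_ext_superset:
  assumes "finite S" "Poly_Mapping.keys p \<subseteq> S"
  shows "linear_ext f p = (\<Sum>w\<in>S. Poly_Mapping.single (f w) (Poly_Mapping.lookup p w))"
  unfolding linear_ext_def
  by (rule sum.mono_neutral_left) (use assms in \<open>auto simp: in_keys_iff\<close>)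

lemma linear_ext_zero [simp]: "linear_ext f 0 = 0"
  by (simp add: linear_ext_def)

lemma linear_ext_single [simp]:
  "linear_ext f (Poly_Mapping.single w a) = Poly_Mapping.single (f w) a"
  using linear_ext_superset[of "{w}" "Poly_Mapping.single w a" f] by (simp add: keys_single)

lemma linear_ext_add: "linear_ext f (p + q) = linear_ext f p + linear_ext f q"
proof -
  let ?S = "Poly_Mapping.keys p \<union> Poly_Mapping.keys q"
  have "Poly_Mapping.keys (p + q) \<subseteq> ?S" by (rule Poly_Mapping.keys_add)
  then show ?thesis
    by (simp add: linear_ext_superset[of ?S] lookup_add single_add sum.distrib)
qed

lemma linear_ext_uminus: "linear_ext f (- p) = - linear_ext f (p :: _ \<Rightarrow>\<^sub>0 'k::ab_group_add)"
  using linear_ext_add[of f p "- p"] by (simp add: eq_neg_iff_add_eq_0 add.commute)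

lemma linear_ext_diff:
  "linear_ext f (p - q) = linear_ext f p - linear_ext f (q :: _ \<Rightarrow>\<^sub>0 'k::ab_group_add)"
  using linear_ext_add[of f p "- q"] by (simp add: linear_ext_uminus)

lemma linear_ext_sum: "linear_ext f (sum g S) = (\<Sum>s\<in>S. linear_ext f (g s))"
  by (induct S rule: infinite_finite_induct) (simp_all add: linear_ext_add)

lemma sum_singles: "p = (\<Sum>w\<in>Poly_Mapping.keys p. Poly_Mapping.single w (Poly_Mapping.lookup p w))"
  by (rule poly_mapping_eqI) (simp add: lookup_sum lookup_single when_def in_keys_iff)

lemma linear_ext_comp: "linear_ext f (linear_ext g p) = linear_ext (\<lambda>w. f (g w)) p"
  by (simp add: linear_ext_def[of g] linear_ext_def[of "\<lambda>w. f (g w)"] linear_ext_sum)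

text \<open>By bilinearity it suffices to multiply single terms, where multiplicativity is the
  additivity of \<open>f\<close>.\<close>

lemma linear_ext_mult:
  fixes p q :: "'m::monoid_add \<Rightarrow>\<^sub>0 'k::comm_ring_1" and f :: "'m \<Rightarrow> 'n::monoid_add"
  assumes "\<And>u v. f (u + v) = f u + f v"
  shows "linear_ext f (p * q) = linear_ext f p * linear_ext f q"
proof -
  have "linear_ext f (p * q) = linear_ext f
     ((\<Sum>w\<in>Poly_Mapping.keys p. Poly_Mapping.single w (Poly_Mapping.lookup p w)) *
      (\<Sum>w\<in>Poly_Mapping.keys q. Poly_Mapping.single w (Poly_Mapping.lookup q w)))"
    using sum_singles[of p] sum_singles[of q] by simp
  also have "\<dots> = linear_ext f p * linear_ext f q"
    by (simp add: sum_product linear_ext_sum mult_single assms linear_ext_def[of f p] linear_ext_def[of f q])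
  finally show ?thesis .
qed

lemma linear_ext_commute:
  fixes p :: "'l \<Rightarrow>\<^sub>0 'k::comm_ring_1" and f :: "'l \<Rightarrow> 'n::monoid_add"
  assumes "\<And>u v. f u + g v = g v + f u"
  shows "linear_ext f p * linear_ext g q = linear_ext g q * linear_ext f p"
  unfolding linear_ext_def sum_product
  by (subst sum.swap) (simp add: mult_single assms mult.commute)

lemma linear_ext_scalar:
  "f 0 = 0 \<Longrightarrow> linear_ext f (scalar a) = scalar a"
  by (simp add: scalar_def)

lemma scalar_commute:
  fixes p :: "'m::monoid_add \<Rightarrow>\<^sub>0 'k::comm_ring_1"
  shows "scalar a * p = p * scalar a"
proof -
  \<comment> \<open>The scalar becomes an image of \<open>linear_ext\<close> over the one-element
    type; its exponent 0 commutes with every exponent.\<close>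
  have "scalar a = linear_ext (\<lambda>_::unit. 0::'m) (Poly_Mapping.single () a)"
    by (simp add: scalar_def)
  moreover have "p = linear_ext (\<lambda>w. w) p"
    unfolding linear_ext_def by (rule sum_singles)
  ultimately show ?thesis
    using linear_ext_commute[of "\<lambda>_::unit. 0::'m" "\<lambda>w. w" "Poly_Mapping.single () a" p] by simp
qed

lemma commutator_linear_ext:
  fixes p q :: "'m::monoid_add \<Rightarrow>\<^sub>0 'k::comm_ring_1" and f :: "'m \<Rightarrow> 'n::monoid_add"
  assumes "\<And>u v. f (u + v) = f u + f v"
  shows "linear_ext f (commutator p q) = commutator (linear_ext f p) (linear_ext f q)"
  by (simp add: commutator_def linear_ext_diff linear_ext_mult[OF assms])

section \<open>The congruence modulo a two-sided ideal\<close>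

lemma two_sided_ideal_left: "p \<in> two_sided_ideal S \<Longrightarrow> u * p \<in> two_sided_ideal S"
  using ideal_mult[of p S u 1] by simp

lemma two_sided_ideal_right: "p \<in> two_sided_ideal S \<Longrightarrow> p * u \<in> two_sided_ideal S"
  using ideal_mult[of p S 1 u] by simp

lemma two_sided_ideal_uminus: "p \<in> two_sided_ideal S \<Longrightarrow> - p \<in> two_sided_ideal S"
  using two_sided_ideal_left[of p S "- 1"] by simp

lemma U_eq_refl [simp]: "U_eq s b p p"
  by (simp add: U_eq_def ideal_zero)

lemma U_eq_sym: "U_eq s b p q \<Longrightarrow> U_eq s b q p"
  unfolding U_eq_def using two_sided_ideal_uminus by fastforce

lemma U_eq_trans [trans]: "U_eq s b p q \<Longrightarrow> U_eq s b q t \<Longrightarrow> U_eq s b p t"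
  unfolding U_eq_def using ideal_add[of "p - q" _ "q - t"] by simp

lemma U_eq_add: "U_eq s b p p' \<Longrightarrow> U_eq s b q q' \<Longrightarrow> U_eq s b (p + q) (p' + q')"
  unfolding U_eq_def using ideal_add[of "p - p'" _ "q - q'"] by (simp add: algebra_simps)

lemma U_eq_uminus: "U_eq s b p p' \<Longrightarrow> U_eq s b (- p) (- p')"
  unfolding U_eq_def using two_sided_ideal_uminus[of "p - p'"] by simp

lemma U_eq_diff: "U_eq s b p p' \<Longrightarrow> U_eq s b q q' \<Longrightarrow> U_eq s b (p - q) (p' - q')"
  using U_eq_add[OF _ U_eq_uminus, of s b p p' q q'] by simp

lemma U_eq_mult:
  assumes "U_eq s b p p'" "U_eq s b q q'"
  shows "U_eq s b (p * q) (p' * q')"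
proof -
  have "p * q - p' * q' = (p - p') * q + p' * (q - q')" by (simp add: algebra_simps)
  then show ?thesis
    using assms unfolding U_eq_def
    by (simp add: ideal_add two_sided_ideal_left two_sided_ideal_right)
qed

lemma U_eq_commutator:
  "U_eq s b p p' \<Longrightarrow> U_eq s b q q' \<Longrightarrow> U_eq s b (commutator p q) (commutator p' q')"
  by (simp add: commutator_def U_eq_diff U_eq_mult)

lemma U_eq_sum:
  "(\<And>x. x \<in> X \<Longrightarrow> U_eq s b (f x) (g x)) \<Longrightarrow> U_eq s b (sum f X) (sum g X)"
  by (induct X rule: infinite_finite_induct) (simp_all add: U_eq_add)

lemma U_eq_sum_list:
  "(\<And>x. x \<in> set xs \<Longrightarrow> U_eq s b (f x) (g x)) \<Longrightarrow>
    U_eq s b (\<Sum>x\<leftarrow>xs. f x) (\<Sum>x\<leftarrow>xs. g x)"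
  by (induct xs) (simp_all add: U_eq_add)

lemma U_eq_diff_iff: "U_eq s b (p - q) 0 \<longleftrightarrow> U_eq s b p q"
  by (simp add: U_eq_def)

section \<open>Commutator calculus in a ring\<close>

lemma commutator_simps:
  "commutator (p + q) t = commutator p t + commutator q t"
  "commutator t (p + q) = commutator t p + commutator t q"
  "commutator (p - q) t = commutator p t - commutator q t"
  "commutator t (p - q) = commutator t p - commutator t q"
  "commutator (- p) t = - commutator p t"
  "commutator t (- p) = - commutator t p"
  "commutator 0 t = 0" "commutator t 0 = 0"
  for p q t :: "'r::ring"
  by (simp_all add: commutator_def algebra_simps)

lemma commutator_sum_left: "commutator (sum f X) t = (\<Sum>x\<in>X. commutator (f x) t)" for t :: "'r::ring"
  by (induct X rule: infinite_finite_induct) (simp_all add: commutator_simps)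

lemma commutator_sum_right: "commutator t (sum f X) = (\<Sum>x\<in>X. commutator t (f x))" for t :: "'r::ring"
  by (induct X rule: infinite_finite_induct) (simp_all add: commutator_simps)

lemma commutator_sum_list_left:
  "commutator (\<Sum>x\<leftarrow>xs. f x) t = (\<Sum>x\<leftarrow>xs. commutator (f x) t)" for t :: "'r::ring"
  by (induct xs) (simp_all add: commutator_simps)

lemma commutator_sum_list_right:
  "commutator t (\<Sum>x\<leftarrow>xs. f x) = (\<Sum>x\<leftarrow>xs. commutator t (f x))" for t :: "'r::ring"
  by (induct xs) (simp_all add: commutator_simps)

lemma commutator_mult_left: "commutator (p * q) t = p * commutator q t + commutator p t * q" for t :: "'r::ring"
  by (simp add: commutator_def algebra_simps)

lemma commutator_mult_right: "commutator t (p * q) = commutator t p * q + p * commutator t q" for t :: "'r::ring"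
  by (simp add: commutator_def algebra_simps)

text \<open>The Jacobi identity in the shape of the compatibility of a cobracket with the Lie
  bracket.\<close>

lemma commutator_jacobi:
  "commutator t (commutator p q) = commutator (commutator t p) q - commutator (commutator t q) p" for t :: "'r::ring"
  by (simp add: commutator_def algebra_simps)

section \<open>Tensor powers\<close>

text \<open>The map of exponents behind \<open>slot\<close>; through it, facts about
  \<open>slot\<close>, \<open>leg\<close> and \<open>swap\<close> reduce to facts about
  words.\<close>

definition at_pos :: "'i \<Rightarrow> 'a word \<Rightarrow> 'i \<Rightarrow> 'a word" where
  "at_pos i w = (\<lambda>k. if k = i then w else 0)"

lemma at_pos_add: "at_pos i (u + v) = at_pos i u + at_pos i v"
  by (auto simp: at_pos_def)

lemma at_pos_zero [simp]: "at_pos i 0 = 0"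
  by (auto simp: at_pos_def)

lemma at_pos_commute: "i \<noteq> j \<Longrightarrow> at_pos i u + at_pos j v = at_pos j v + at_pos i u"
  by (auto simp: at_pos_def)

lemma slot_at: "slot i = linear_ext (at_pos i)"
  unfolding at_pos_def slot_def ..

lemma slot_hom:
  fixes u v :: "('a, 'k::comm_ring_1) free_algebra"
  shows "slot i (u + v) = slot i u + slot i v" "slot i (u - v) = slot i u - slot i v"
    "slot i (u * v) = slot i u * slot i v" "slot i (scalar a) = (scalar a :: ('i, 'a, 'k) free_tensor)"
    "slot i (commutator u v) = commutator (slot i u) (slot i v)"
  by (simp_all add: slot_at linear_ext_add linear_ext_diff linear_ext_mult at_pos_add linear_ext_scalar
      commutator_linear_ext)

lemma slot_commute:
  fixes u v :: "('a, 'k::comm_ring_1) free_algebra"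
  shows "i \<noteq> j \<Longrightarrow> slot i u * slot j v = slot j v * slot i u"
  unfolding slot_at by (rule linear_ext_commute) (simp add: at_pos_commute)

lemma slot_letter: "slot i (letter x) = Poly_Mapping.single (at_pos i (Word [x])) 1"
  by (simp add: slot_at letter_def)

abbreviation leg_word :: "'i \<Rightarrow> 'i \<Rightarrow> (2 \<Rightarrow> 'a word) \<Rightarrow> 'i \<Rightarrow> 'a word" where
  "leg_word i j \<equiv> (\<lambda>w k. if k = i then w 1 else if k = j then w 2 else 0)"

abbreviation swap_word :: "'i \<Rightarrow> 'i \<Rightarrow> ('i \<Rightarrow> 'a word) \<Rightarrow> 'i \<Rightarrow> 'a word" where
  "swap_word i j \<equiv> (\<lambda>w k. w (Transposition.transpose i j k))"

lemma leg_word_at: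
  "i \<noteq> j \<Longrightarrow> leg_word i j (at_pos 1 w) = at_pos i w"
  "i \<noteq> j \<Longrightarrow> leg_word i j (at_pos 2 w) = at_pos j w"
  by (auto simp: at_pos_def fun_eq_iff)

lemma swap_word_at: "swap_word i j (at_pos k w) = at_pos (Transposition.transpose i j k) w"
  by (auto simp: at_pos_def fun_eq_iff transpose_eq_iff)

lemma leg_slot:
  assumes "i \<noteq> j"
  shows "leg i j (slot 1 u) = slot i u" "leg i j (slot 2 u) = slot j u"
  unfolding leg_def slot_at linear_ext_comp leg_word_at[OF assms] by simp_all

lemma swap_slot: "swap i j (slot k u) = slot (Transposition.transpose i j k) u"
  unfolding swap_def slot_at linear_ext_comp swap_word_at by simp

lemma leg_hom:
  fixes p q :: "(2, 'a, 'k::comm_ring_1) free_tensor"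
  shows "leg i j (p + q) = leg i j p + leg i j q" "leg i j (p - q) = leg i j p - leg i j q"
    "leg i j (- p) = - leg i j p"
    "leg i j (sum f X) = (\<Sum>x\<in>X. leg i j (f x))"
    "leg i j (p * q) = leg i j p * leg i j q"
    "leg i j (commutator p q) = commutator (leg i j p) (leg i j q)"
  by (simp_all add: leg_def linear_ext_add linear_ext_diff linear_ext_uminus linear_ext_sum
      linear_ext_mult commutator_linear_ext fun_eq_iff)

lemma swap_hom:
  fixes p q :: "('i, 'a, 'k::comm_ring_1) free_tensor"
  shows "swap i j (p + q) = swap i j p + swap i j q" "swap i j (p - q) = swap i j p - swap i j q"
    "swap i j (- p) = - swap i j p"
    "swap i j (sum f X) = (\<Sum>x\<in>X. swap i j (f x))"
    "swap i j (p * q) = swap i j p * swap i j q"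
    "swap i j (commutator p q) = commutator (swap i j p) (swap i j q)"
  by (simp_all add: swap_def linear_ext_add linear_ext_diff linear_ext_uminus linear_ext_sum
      linear_ext_mult commutator_linear_ext fun_eq_iff)

lemma linear_ext_id [simp]: "linear_ext (\<lambda>w. w) p = p"
  using sum_singles[of p] by (simp add: linear_ext_def)

lemma swap_swap [simp]: "swap i j (swap i j p) = p"
  by (simp add: swap_def linear_ext_comp)

lemma leg_swap: "i \<noteq> j \<Longrightarrow> leg i j (swap 1 2 p) = leg j i p"
  unfolding leg_def swap_def linear_ext_comp by (rule arg_cong[where f = "\<lambda>f. linear_ext f p"]) (auto simp: fun_eq_iff)

lemma swap_leg:
  "swap k l (leg i j p) = leg (Transposition.transpose k l i) (Transposition.transpose k l j) p"
proof -
  \<comment> \<open>A transposition is its own inverse, so testing the transposed position against a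
    leg is testing the position against the transposed leg.\<close>
  have "Transposition.transpose k l m = n \<longleftrightarrow> m = Transposition.transpose k l n" for m n
    by (metis transpose_involutory)
  then show ?thesis
    unfolding leg_def swap_def linear_ext_comp by (simp only:)
qed

lemma leg_slot_commute:
  fixes p :: "(2, 'a, 'k::comm_ring_1) free_tensor"
  shows "k \<noteq> i \<Longrightarrow> k \<noteq> j \<Longrightarrow> leg i j p * slot k u = slot k u * leg i j p"
  unfolding slot_at leg_def by (rule linear_ext_commute) (auto simp: at_pos_def fun_eq_iff)

lemma tensor_sum_append: "tensor_sum (ts @ us) = tensor_sum ts + tensor_sum us"
  by (simp add: tensor_sum_def)

lemma leg_tensor_sum:
  "i \<noteq> j \<Longrightarrow> leg i j (tensor_sum ts) = (\<Sum>(a, b)\<leftarrow>ts. slot i (letter a) * slot j (letter b))"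
  by (induct ts) (auto simp: tensor_sum_def leg_hom leg_slot split: prod.splits, simp add: leg_def)

lemma swap_tensor_sum: "swap 1 2 (tensor_sum ts) = tensor_sum (map (\<lambda>(a, b). (b, a)) ts)"
  by (induct ts) (auto simp: tensor_sum_def swap_hom swap_slot slot_commute[of 2 1] split: prod.splits, simp add: swap_def)

lemma leg_comult: "i \<noteq> j \<Longrightarrow> leg i j (comult x) = slot i (letter x) + slot j (letter x)"
  by (simp add: comult_def leg_hom leg_slot)

lemma swap_comult: "swap 1 2 (comult x) = comult x"
  by (simp add: comult_def swap_hom swap_slot)

section \<open>Congruences induced by Lie algebra homomorphisms\<close>

definition lie_hom where
  "lie_hom s b s' b' h \<longleftrightarrow> (\<forall>x y. h (x + y) = h x + h y) \<and> (\<forall>a x. h (s a x) = s' a (h x)) \<and>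
     (\<forall>x y. h (b x y) = b' (h x) (h y))"

lemma map_word_add: "map_word h (u + v) = map_word h u + map_word h v"
  by (simp add: plus_word_def word.map_sel)

lemma map_word_zero [simp]: "map_word h 0 = 0"
  by (simp add: zero_word_def)

lemma linear_ext_letter: "linear_ext (map_word h) (letter x) = letter (h x)"
  by (simp add: letter_def)

text \<open>Functoriality of the enveloping algebra at the level of generators: each of the three
  kinds of relation goes to one of the same kind.\<close>

lemma envelope_relations_image:
  fixes s :: "'k::field \<Rightarrow> 'a::ab_group_add \<Rightarrow> 'a" and s' :: "'k \<Rightarrow> 'b::ab_group_add \<Rightarrow> 'b"
  assumes "lie_hom s b s' b' h" and "p \<in> envelope_relations s b"
  shows "linear_ext (map_word h) p \<in> envelope_relations s' b'"
proof -
  note hom = linear_ext_diff linear_ext_add linear_ext_mult[OF map_word_add]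
    commutator_linear_ext[OF map_word_add] linear_ext_letter linear_ext_scalar
  consider (add) x y where "p = letter (x + y) - (letter x + letter y)"
    | (scale) a x where "p = letter (s a x) - scalar a * letter x"
    | (bracket) x y where "p = commutator (letter x) (letter y) - letter (b x y)"
    using assms(2) unfolding envelope_relations_def by blast
  then show ?thesis
  proof cases
    case add
    then have "linear_ext (map_word h) p = letter (h x + h y) - (letter (h x) + letter (h y))"
      using assms(1) by (simp add: hom lie_hom_def)
    then show ?thesis unfolding envelope_relations_def by blast
  next
    case scale
    then have "linear_ext (map_word h) p = letter (s' a (h x)) - scalar a * letter (h x)"
      using assms(1) by (simp add: hom lie_hom_def)
    then show ?thesis unfolding envelope_relations_def by blast
  next
    case bracket
    then have "linear_ext (map_word h) p = commutator (letter (h x)) (letter (h y)) - letter (b' (h x) (h y))"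
      using assms(1) by (simp add: hom lie_hom_def)
    then show ?thesis unfolding envelope_relations_def by blast
  qed
qed

text \<open>Induction over the ideal: a relation in one slot goes to a relation in one slot, and the
  closure rules survive because the induced map is additive and multiplicative. \<open>h\<close> may
  vary with the position, as embeddings into different summands require.\<close>

lemma U_eq_linear_ext:
  fixes s :: "'k::field \<Rightarrow> 'a::ab_group_add \<Rightarrow> 'a" and s' :: "'k \<Rightarrow> 'b::ab_group_add \<Rightarrow> 'b"
    and f :: "('i \<Rightarrow> 'a word) \<Rightarrow> ('j \<Rightarrow> 'b word)"
  assumes add: "\<And>u v. f (u + v) = f u + f v"
    and slots: "\<And>i. \<exists>j h. lie_hom s b s' b' h \<and> (\<forall>w. f (at_pos i w) = at_pos j (map_word h w))"
    and "U_eq s b p q"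
  shows "U_eq s' b' (linear_ext f p) (linear_ext f q)"
proof -
  have "linear_ext f t \<in> two_sided_ideal (\<Union>j. slot j ` envelope_relations s' b')"
    if "t \<in> two_sided_ideal (\<Union>i. slot i ` envelope_relations s b)" for t
    using that
  proof induct
    case (ideal_gen t)
    then obtain i u where t: "t = slot i u" "u \<in> envelope_relations s b" by auto
    obtain j h where h: "lie_hom s b s' b' h" "\<And>w. f (at_pos i w) = at_pos j (map_word h w)"
      using slots by blast
    have "linear_ext f t = slot j (linear_ext (map_word h) u)"
      by (simp add: t slot_at linear_ext_comp h)
    then show ?case
      using envelope_relations_image[OF h(1) t(2)] by (auto intro: two_sided_ideal.ideal_gen)
  qed (simp_all add: linear_ext_add linear_ext_mult[of f, OF add] two_sided_ideal.intros)
  from this[of "p - q"] show ?thesis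
    using assms(3) by (simp add: U_eq_def linear_ext_diff)
qed

text \<open>\<open>leg\<close> and \<open>swap\<close> move words without changing letters, so they
  meet \<open>U_eq_linear_ext\<close> with the identity.\<close>

lemma lie_hom_id: "lie_hom s b s b (\<lambda>x. x)"
  by (simp add: lie_hom_def)

lemma U_eq_leg:
  fixes i j :: 'i
  assumes "i \<noteq> j" and "U_eq s b p q"
  shows "U_eq s b (leg i j p) (leg i j q)"
  unfolding leg_def
proof (rule U_eq_linear_ext[OF _ _ assms(2)])
  have "\<forall>w. leg_word i j (at_pos 1 w) = at_pos i (map_word (\<lambda>x. x) w)"
    "\<forall>w. leg_word i j (at_pos 2 w) = at_pos j (map_word (\<lambda>x. x) w)"
    unfolding word.map_ident using leg_word_at[OF assms(1)] by blast+
  then show "\<exists>l h. lie_hom s b s b h \<and> (\<forall>w. leg_word i j (at_pos k w) = at_pos l (map_word h w))" for k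
    using exhaust_index2[of k] lie_hom_id[of s b] by blast
qed (simp add: fun_eq_iff)

lemma U_eq_swap:
  assumes "U_eq s b p q"
  shows "U_eq s b (swap i j p) (swap i j q)"
  unfolding swap_def
proof (rule U_eq_linear_ext[OF _ _ assms])
  show "\<exists>l h. lie_hom s b s b h \<and> (\<forall>w. swap_word i j (at_pos k w) = at_pos l (map_word h w))" for k
    by (intro exI[of _ "Transposition.transpose i j k"] exI[of _ "\<lambda>x. x"] conjI lie_hom_id allI)
      (simp only: swap_word_at word.map_ident)
qed (simp add: fun_eq_iff)

lemma U_eq_slot:
  assumes "u - v \<in> envelope_relations s b"
  shows "U_eq s b (slot i u) (slot i v)"
  unfolding U_eq_def using assms by (auto intro!: ideal_gen simp flip: slot_hom)

section \<open>Invariant tensors and the Yang-Baxter bracket\<close>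

text \<open>The Yang-Baxter expression with independent arguments: in a direct sum, the component at
  three summands involves three different tensors.\<close>

definition yang_baxter ::
    "(2, 'a, 'k::field) free_tensor \<Rightarrow> (2, 'a, 'k) free_tensor \<Rightarrow> (2, 'a, 'k) free_tensor \<Rightarrow> (3, 'a, 'k) free_tensor" where
  "yang_baxter A B C = commutator (leg 1 2 A) (leg 1 3 B) + commutator (leg 1 2 A) (leg 2 3 C)
     + commutator (leg 1 3 B) (leg 2 3 C)"

lemma CYBE_yang_baxter: "CYBE s b A \<longleftrightarrow> U_eq s b (yang_baxter A A A) 0"
  by (simp add: CYBE_def yang_baxter_def)

context lie_algebra
begin

abbreviation eqv (infix "\<approx>" 50) where "p \<approx> q \<equiv> U_eq scale bracket p q"

lemma bracket_zero [simp]: "bracket 0 x = 0" "bracket x 0 = 0"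
  using bracket_add_left[of 0 0 x] bracket_add_right[of x 0 0] by simp_all

lemma slot_letter_add: "slot i (letter (x + y)) \<approx> slot i (letter x) + slot i (letter y)"
  unfolding slot_hom(1)[symmetric] by (rule U_eq_slot) (auto simp: envelope_relations_def)

lemma slot_letter_scale: "slot i (letter (scale a x)) \<approx> scalar a * slot i (letter x)"
proof -
  have "slot i (letter (scale a x)) \<approx> slot i (scalar a * letter x)"
    by (rule U_eq_slot) (auto simp: envelope_relations_def)
  then show ?thesis by (simp add: slot_hom)
qed

lemma slot_letter_bracket:
  "slot i (letter (bracket x y)) \<approx> commutator (slot i (letter x)) (slot i (letter y))"
  unfolding slot_hom(5)[symmetric] by (rule U_eq_sym, rule U_eq_slot) (auto simp: envelope_relations_def)

lemma slot_letter_zero: "slot i (letter 0) \<approx> 0"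
  using slot_letter_add[of i 0 0] U_eq_diff[OF _ U_eq_refl, of scale bracket "slot i (letter 0)" _ "slot i (letter 0)"]
  by (metis add_0 add_diff_cancel_right' diff_self U_eq_sym)

lemma slot_letter_uminus: "slot i (letter (- x)) \<approx> - slot i (letter x)"
proof -
  have "slot i (letter (x + - x)) \<approx> slot i (letter x) + slot i (letter (- x))"
    by (rule slot_letter_add)
  then have "slot i (letter x) + slot i (letter (- x)) \<approx> 0"
    using slot_letter_zero by (metis U_eq_sym U_eq_trans add.right_inverse)
  then have "slot i (letter (- x)) - (- slot i (letter x)) \<approx> 0"
    by (simp add: add.commute)
  then show ?thesis unfolding U_eq_diff_iff .
qed

lemma commutator_slots [simp]:
  "i \<noteq> j \<Longrightarrow> commutator (slot i (letter x)) (slot j (letter y) :: ('i, 'a, 'k) free_tensor) = 0"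
  by (simp add: commutator_def slot_commute)

lemma comult_add: "comult (x + y) \<approx> comult x + comult y"
  using U_eq_add[OF slot_letter_add slot_letter_add, of 1 x y 2 x y]
  by (simp add: comult_def algebra_simps)

lemma comult_scale: "comult (scale a x) \<approx> scalar a * comult x"
  using U_eq_add[OF slot_letter_scale slot_letter_scale, of 1 a x 2 a x]
  by (simp add: comult_def algebra_simps)

lemma comult_bracket: "comult (bracket x y) \<approx> commutator (comult x) (comult y)"
  using U_eq_add[OF slot_letter_bracket slot_letter_bracket, of 1 x y 2 x y]
  by (simp add: comult_def commutator_simps)

lemma commutator_mult_zero:
  "commutator p t \<approx> 0 \<Longrightarrow> commutator q t \<approx> 0 \<Longrightarrow> commutator (p * q) t \<approx> 0"
  "commutator t p \<approx> 0 \<Longrightarrow> commutator t q \<approx> 0 \<Longrightarrow> commutator t (p * q) \<approx> 0"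
  using U_eq_add[OF U_eq_mult[OF U_eq_refl] U_eq_mult[OF _ U_eq_refl], of scale bracket "commutator q t" 0 "commutator p t" 0 p q]
    U_eq_add[OF U_eq_mult[OF _ U_eq_refl] U_eq_mult[OF U_eq_refl], of scale bracket "commutator t p" 0 "commutator t q" 0 q p]
  by (simp_all add: commutator_mult_left commutator_mult_right)

text \<open>Letters in distinct positions commute already in the free tensor power; in one position
  their commutator is the letter of the bracket.\<close>

lemma commutator_slots_zero:
  assumes "i = j \<Longrightarrow> bracket x y = 0"
  shows "commutator (slot i (letter x)) (slot j (letter y)) \<approx> 0"
proof (cases "i = j")
  case True
  then have "commutator (slot i (letter x)) (slot j (letter y)) \<approx> slot i (letter 0)"
    using U_eq_sym[OF slot_letter_bracket[of i x y]] assms by simp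
  then show ?thesis using slot_letter_zero by (rule U_eq_trans)
qed simp

lemma sum_list_zero: "(\<And>x. x \<in> set xs \<Longrightarrow> f x \<approx> 0) \<Longrightarrow> (\<Sum>x\<leftarrow>xs. f x) \<approx> 0"
  using U_eq_sum_list[of xs scale bracket f "\<lambda>_. 0"] by simp

section \<open>Sums of pure tensors of Lie algebra elements\<close>

abbreviation lie_tensor :: "(2, 'a, 'k) free_tensor \<Rightarrow> bool" where
  "lie_tensor \<equiv> in_lie_tensor scale bracket"

lemma lie_tensor_cong: "p \<approx> q \<Longrightarrow> lie_tensor q \<Longrightarrow> lie_tensor p"
  unfolding in_lie_tensor_def using U_eq_trans by blast

lemma lie_tensor_tensor_sum [simp]: "lie_tensor (tensor_sum ts)"
  unfolding in_lie_tensor_def using U_eq_refl by blast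

lemma lie_tensor_add: "lie_tensor p \<Longrightarrow> lie_tensor q \<Longrightarrow> lie_tensor (p + q)"
  unfolding in_lie_tensor_def using U_eq_add by (metis tensor_sum_append)

lemma lie_tensor_zero: "lie_tensor 0"
  using lie_tensor_tensor_sum[of "[]"] by (simp add: tensor_sum_def)

lemma lie_tensor_sum: "(\<And>x. x \<in> X \<Longrightarrow> lie_tensor (f x)) \<Longrightarrow> lie_tensor (sum f X)"
  by (induct X rule: infinite_finite_induct) (simp_all add: lie_tensor_add lie_tensor_zero)

text \<open>A \<open>tensor_sum\<close> has no coefficients, so the sign is absorbed in the first
  factor; this holds only up to congruence.\<close>

lemma tensor_sum_uminus: "tensor_sum (map (\<lambda>(a, b). (- a, b)) ts) \<approx> - tensor_sum ts"
proof (induct ts)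
  case (Cons t ts)
  obtain a b where t: "t = (a, b)" by (cases t)
  have "slot 1 (letter (- a)) * slot 2 (letter b) \<approx> - slot 1 (letter a) * slot 2 (letter b)"
    by (rule U_eq_mult[OF slot_letter_uminus U_eq_refl])
  from U_eq_add[OF this Cons] show ?case by (simp add: t tensor_sum_def)
qed (simp add: tensor_sum_def)

lemma lie_tensor_uminus: "lie_tensor p \<Longrightarrow> lie_tensor (- p)"
  unfolding in_lie_tensor_def using U_eq_trans[OF U_eq_uminus U_eq_sym[OF tensor_sum_uminus]] by blast

lemma lie_tensor_swap: "lie_tensor p \<Longrightarrow> lie_tensor (swap 1 2 p)"
  unfolding in_lie_tensor_def using U_eq_swap swap_tensor_sum by metis

lemma commutator_comult_pure:
  "commutator (slot 1 (letter p) * slot 2 (letter q)) (comult y) \<approx>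
    slot 1 (letter (bracket p y)) * slot 2 (letter q) + slot 1 (letter p) * slot 2 (letter (bracket q y))"
proof -
  have "commutator (slot 1 (letter p) * slot 2 (letter q) :: (2, 'a, 'k) free_tensor) (comult y) =
      commutator (slot 1 (letter p)) (slot 1 (letter y)) * slot 2 (letter q)
      + slot 1 (letter p) * commutator (slot 2 (letter q)) (slot 2 (letter y))"
    by (simp add: comult_def commutator_simps commutator_mult_left)
  then show ?thesis
    by (simp add: U_eq_add U_eq_mult U_eq_sym slot_letter_bracket)
qed

text \<open>The commutator acts as a derivation on both factors; the resulting list witnesses that
  coboundaries stay in the tensor square of the Lie algebra.\<close>

lemma commutator_comult_tensor_sum:
  "commutator (tensor_sum ts) (comult y) \<approx>
    tensor_sum (concat (map (\<lambda>(p, q). [(bracket p y, q), (p, bracket q y)]) ts))"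
proof (induct ts)
  case (Cons t ts)
  obtain p q where t: "t = (p, q)" by (cases t)
  from U_eq_add[OF commutator_comult_pure Cons, of p q] show ?case
    by (simp add: t tensor_sum_def commutator_simps algebra_simps)
qed (simp add: tensor_sum_def commutator_simps)

lemma lie_tensor_coboundary:
  assumes "lie_tensor r" shows "lie_tensor (coboundary r x)"
proof -
  obtain ts where "r \<approx> tensor_sum ts" using assms by (auto simp: in_lie_tensor_def)
  then have "coboundary r x \<approx> commutator (tensor_sum ts) (comult x)"
    by (simp add: coboundary_def U_eq_commutator)
  then show ?thesis
    by (meson U_eq_trans commutator_comult_tensor_sum lie_tensor_cong lie_tensor_tensor_sum)
qed

section \<open>Ad-invariant tensors\<close>

definition invariant :: "(2, 'a, 'k) free_tensor \<Rightarrow> bool" where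
  "invariant p \<longleftrightarrow> (\<forall>x. coboundary p x \<approx> 0)"

lemma coboundary_hom:
  "coboundary (p + q) x = coboundary p x + coboundary q x"
  "coboundary (p - q) x = coboundary p x - coboundary q x"
  "coboundary (- p) x = - coboundary p x"
  by (simp_all add: coboundary_def commutator_simps)

lemma coboundary_swap: "coboundary (swap 1 2 p) x = swap 1 2 (coboundary p x)"
  by (simp add: coboundary_def swap_hom swap_comult)

text \<open>Both sides are \<open>\<delta> \<otimes> id\<close> applied to \<open>tensor_sum ts\<close>, for \<open>\<delta>\<close> the coboundary of \<open>p\<close>.\<close>

lemma commutator_leg_legs:
  assumes "i \<noteq> j" "k \<noteq> j" "i \<noteq> k"
  shows "commutator (leg i k p) (leg i j (tensor_sum ts) + leg k j (tensor_sum ts)) =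
    (\<Sum>(a, b)\<leftarrow>ts. leg i k (coboundary p a) * slot j (letter b))"
proof (induct ts)
  case Nil
  then show ?case by (simp add: tensor_sum_def leg_def commutator_simps)
next
  case (Cons t ts)
  obtain a b where t: "t = (a, b)" by (cases t)
  \<comment> \<open>Position \<open>j\<close> lies off the legs of \<open>p\<close>. The two copies
    of \<open>a\<close> form its comultiplication on these legs and produce the coboundary.\<close>
  have "commutator (leg i k p) (slot j (letter b)) = 0"
    using assms by (simp add: commutator_def leg_slot_commute)
  then have "commutator (leg i k p) ((slot i (letter a) + slot k (letter a)) * slot j (letter b)) =
      leg i k (coboundary p a) * slot j (letter b)"
    using assms by (simp add: coboundary_def leg_hom leg_comult commutator_mult_right)
  with Cons show ?case
    using assms by (simp add: t leg_tensor_sum commutator_simps algebra_simps)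
qed

text \<open>Expanding \<open>q\<close> into pure tensors, its first factors on the positions
  \<open>i\<close> and \<open>k\<close> add up to comultiplications, which commute with
  \<open>p\<close>.\<close>

lemma invariant_legs:
  assumes "invariant p" "lie_tensor q" and ne: "i \<noteq> j" "k \<noteq> j" "i \<noteq> k"
  shows "commutator (leg i k p) (leg i j q + leg k j q) \<approx> 0"
proof -
  obtain ts where ts: "q \<approx> tensor_sum ts" using assms(2) by (auto simp: in_lie_tensor_def)
  have "commutator (leg i k p) (leg i j q + leg k j q)
      \<approx> commutator (leg i k p) (leg i j (tensor_sum ts) + leg k j (tensor_sum ts))"
    by (intro U_eq_commutator U_eq_add U_eq_leg U_eq_refl ts ne)
  also have "\<dots> = (\<Sum>t\<leftarrow>ts. leg i k (coboundary p (fst t)) * slot j (letter (snd t)))"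
    using ne by (simp add: commutator_leg_legs case_prod_unfold)
  also have "\<dots> \<approx> (\<Sum>t\<leftarrow>ts. leg i k 0 * slot j (letter (snd t)))"
    using assms(1) by (intro U_eq_sum_list U_eq_mult U_eq_leg ne U_eq_refl) (simp add: invariant_def)
  also have "\<dots> = 0" by (simp add: leg_def)
  finally show ?thesis .
qed

lemma invariant_legs_swapped:
  assumes "invariant p" "lie_tensor q" and ne: "i \<noteq> j" "k \<noteq> j" "i \<noteq> k"
  shows "commutator (leg i k p) (leg j i q + leg j k q) \<approx> 0"
  using invariant_legs[OF assms(1) lie_tensor_swap[OF assms(2)] ne] ne by (simp add: leg_swap)

lemma invariant_sum: "(\<And>x. x \<in> X \<Longrightarrow> invariant (f x)) \<Longrightarrow> invariant (sum f X)"
  unfolding invariant_def coboundary_def commutator_sum_left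
proof
  fix y
  assume "\<And>x. x \<in> X \<Longrightarrow> \<forall>y. commutator (f x) (comult y) \<approx> 0"
  then show "(\<Sum>x\<in>X. commutator (f x) (comult y)) \<approx> 0"
    using U_eq_sum[of X scale bracket "\<lambda>x. commutator (f x) (comult y)" "\<lambda>_. 0"] by simp
qed

text \<open>The conditions of \<open>quasi_triangular\<close> on the tensor itself, with the
  cobracket fixed: the class within which tensors are exchanged for one another.\<close>

definition r_matrix :: "('a \<Rightarrow> (2, 'a, 'k) free_tensor) \<Rightarrow> (2, 'a, 'k) free_tensor \<Rightarrow> bool" where
  "r_matrix \<delta> p \<longleftrightarrow> lie_tensor p \<and> (\<forall>x. \<delta> x \<approx> coboundary p x) \<and> CYBE scale bracket p"

lemma invariant_diff_r_matrix:
  assumes "r_matrix \<delta> p" "r_matrix \<delta> q"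
  shows "invariant (p - q)"
  unfolding invariant_def coboundary_hom U_eq_diff_iff
  using assms U_eq_trans U_eq_sym unfolding r_matrix_def by blast

text \<open>Reversing the positions exchanges the roles of \<open>A\<close> and \<open>C\<close>,
  transposes each tensor and reverses the order in every commutator.\<close>

lemma yang_baxter_swap_13:
  "swap 1 3 (yang_baxter A B C) =
    - yang_baxter (swap 1 2 C) (swap 1 2 B) (swap 1 2 A)"
proof -
  have "swap 1 3 (yang_baxter A B C) = commutator (leg 3 2 A) (leg 3 1 B)
      + commutator (leg 3 2 A) (leg 2 1 C) + commutator (leg 3 1 B) (leg 2 1 C)"
    by (simp add: yang_baxter_def swap_hom swap_leg)
  then show ?thesis
    by (simp add: yang_baxter_def leg_swap commutator_def)
qed

text \<open>The first two legs change places and the third is transposed. Negating the third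
  argument gives all three commutators the same sign.\<close>

lemma yang_baxter_swap_23:
  "swap 2 3 (yang_baxter A B C) = - yang_baxter B A (- swap 1 2 C)"
proof -
  have "swap 2 3 (yang_baxter A B C) = commutator (leg 1 3 A) (leg 1 2 B)
      + commutator (leg 1 3 A) (leg 3 2 C) + commutator (leg 1 2 B) (leg 3 2 C)"
    by (simp add: yang_baxter_def swap_hom swap_leg)
  then show ?thesis
    by (simp add: yang_baxter_def leg_swap commutator_def leg_hom)
qed

lemma yang_baxter_uminus: "yang_baxter (- A) (- B) (- C) = yang_baxter A B C"
  by (simp add: yang_baxter_def leg_hom commutator_simps)

text \<open>Skewness makes the negated transpose have the same coboundary. Its CYBE is that of
  \<open>p\<close> with positions 1 and 3 exchanged, the signs cancelling because the expression is
  quadratic.\<close>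

lemma r_matrix_uminus_swap:
  assumes "r_matrix \<delta> p" and skew: "\<And>x. swap 1 2 (\<delta> x) \<approx> - \<delta> x"
  shows "r_matrix \<delta> (- swap 1 2 p)"
  unfolding r_matrix_def
proof (intro conjI allI)
  show "lie_tensor (- swap 1 2 p)"
    using assms by (simp add: r_matrix_def lie_tensor_uminus lie_tensor_swap)
  show "\<delta> x \<approx> coboundary (- swap 1 2 p) x" for x
  proof -
    have "\<delta> x \<approx> - swap 1 2 (\<delta> x)" using U_eq_uminus[OF U_eq_sym[OF skew[of x]]] by simp
    also have "\<dots> \<approx> - swap 1 2 (coboundary p x)"
      using assms by (intro U_eq_uminus U_eq_swap) (simp add: r_matrix_def)
    finally show ?thesis by (simp add: coboundary_hom coboundary_swap)
  qed
  have "swap 1 3 (yang_baxter p p p) \<approx> swap 1 3 0"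
    using assms by (intro U_eq_swap) (simp add: r_matrix_def CYBE_yang_baxter)
  from U_eq_uminus[OF this] show "CYBE scale bracket (- swap 1 2 p)"
    by (simp add: CYBE_yang_baxter yang_baxter_swap_13 yang_baxter_uminus) (simp add: swap_def)
qed

lemma yang_baxter_r_matrix:
  assumes "r_matrix \<delta> A" "r_matrix \<delta> B" "r_matrix \<delta> C"
    and "A = B \<or> B = C \<or> C = - swap 1 2 A"
  shows "yang_baxter A B C \<approx> 0"
proof -
  have AAA: "yang_baxter A A A \<approx> 0" and BBB: "yang_baxter B B B \<approx> 0" and lie: "lie_tensor A" "lie_tensor B"
    using assms by (simp_all add: r_matrix_def CYBE_yang_baxter)
  consider "A = B" | "B = C" | "C = - swap 1 2 A" using assms(4) by blast
  then show ?thesis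
  proof cases
    case 1
    \<comment> \<open>\<open>C\<close> enters only through its commutators with the legs 12 and 13
      of \<open>A\<close>, so replacing it by \<open>A\<close> costs exactly this term.\<close>
    have "commutator (leg (2::3) 3 (A - C)) (leg 1 2 A + leg 1 3 A) \<approx> 0"
      using assms lie by (intro invariant_legs_swapped invariant_diff_r_matrix) simp_all
    from U_eq_add[OF AAA this] show ?thesis
      by (simp add: 1 yang_baxter_def leg_hom commutator_def algebra_simps)
  next
    case 2
    \<comment> \<open>Here \<open>A\<close> enters only through its commutators with the legs 13 and
      23 of \<open>B\<close>.\<close>
    have "commutator (leg (1::3) 2 (A - B)) (leg 1 3 B + leg 2 3 B) \<approx> 0"
      using assms lie by (intro invariant_legs invariant_diff_r_matrix) simp_all
    from U_eq_add[OF BBB this] show ?thesis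
      by (simp add: 2 yang_baxter_def leg_hom commutator_def algebra_simps)
  next
    case 3
    \<comment> \<open>The leg 23 of \<open>C\<close> is minus the leg 32 of \<open>A\<close>, so
      \<open>B\<close> meets the legs 12 and 32 of \<open>A\<close>. The equation left after
      replacing \<open>B\<close> is the CYBE of \<open>A\<close> with positions 2 and 3
      exchanged.\<close>
    have "commutator (leg (1::3) 3 (A - B)) (leg 1 2 A + leg 3 2 A) \<approx> 0"
      using assms lie by (intro invariant_legs invariant_diff_r_matrix) simp_all
    moreover have "yang_baxter A A (- swap 1 2 A) \<approx> 0"
      using U_eq_uminus[OF U_eq_swap[OF AAA, of 2 3]]
      by (simp add: yang_baxter_swap_23) (simp add: swap_def)
    ultimately have "yang_baxter A A (- swap 1 2 A)
        + commutator (leg 1 3 (A - B)) (leg 1 2 A + leg 3 2 A) \<approx> 0 + 0"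
      by (intro U_eq_add)
    then show ?thesis
      by (simp add: 3 yang_baxter_def leg_hom leg_swap commutator_def algebra_simps)
  qed
qed

section \<open>Coboundary Lie bialgebras\<close>

text \<open>With invariant symmetric part, the cyclic sum is the commutator of the Yang-Baxter
  expression of \<open>r\<close> with the iterated comultiplication of \<open>x\<close>, here
  \<open>X\<close>.\<close>

lemma coboundary_co_jacobi:
  assumes "lie_tensor r" and cybe: "CYBE scale bracket r" and inv: "invariant (r + swap 1 2 r)"
    and ts: "coboundary r x \<approx> tensor_sum ts"
  defines "t \<equiv> cobracket_id (coboundary r) ts"
  shows "t + swap 1 2 (swap 2 3 t) + swap 2 3 (swap 1 2 t) \<approx> 0"
proof -
  define P where "P = coboundary r x"
  define X :: "(3, 'a, 'k) free_tensor" where "X = slot 1 (letter x) + slot 2 (letter x) + slot 3 (letter x)"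
  \<comment> \<open>By \<open>commutator_leg_legs\<close>, the term \<open>t\<close> is congruent to
    an expression in \<open>P\<close> that no longer mentions the list \<open>ts\<close>.\<close>
  define t' :: "(3, 'a, 'k) free_tensor" where "t' = commutator (leg 1 2 r) (leg 1 3 P + leg 2 3 P)"
  have "t = commutator (leg 1 2 r) (leg 1 3 (tensor_sum ts) + leg 2 3 (tensor_sum ts))"
    by (subst commutator_leg_legs) (simp_all add: t_def cobracket_id_def)
  also have "\<dots> \<approx> t'"
    unfolding t'_def P_def
    by (intro U_eq_commutator U_eq_add U_eq_leg U_eq_refl U_eq_sym[OF ts]) simp_all
  finally have t: "t \<approx> t'" .
  have s1: "swap 1 2 (swap 2 3 t') = commutator (leg 2 3 r) (leg 2 1 P + leg 3 1 P)"
    by (simp add: t'_def swap_hom swap_leg)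
  have s2: "swap 2 3 (swap 1 2 t') = commutator (leg 3 1 r) (leg 3 2 P + leg 1 2 P)"
    by (simp add: t'_def swap_hom swap_leg)
  \<comment> \<open>The coboundary of the symmetric part vanishes, which makes \<open>P\<close>
    skew.\<close>
  have skew: "leg j i P \<approx> - leg i j P" if "i \<noteq> j" for i j :: 3
  proof -
    have "leg i j (coboundary (r + swap 1 2 r) x) \<approx> leg i j 0"
      using inv that by (intro U_eq_leg) (simp_all add: invariant_def)
    then have "leg j i P - (- leg i j P) \<approx> 0"
      using that by (simp add: P_def coboundary_hom coboundary_swap leg_hom leg_swap add.commute)
        (simp add: leg_def)
    then show ?thesis unfolding U_eq_diff_iff .
  qed
  \<comment> \<open>Invariance of the symmetric part permits replacing the leg 31 of
    \<open>r\<close> by minus the leg 13, so that only the legs 12, 13 and 23 remain.\<close>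
  have "commutator (leg (1::3) 3 (r + swap 1 2 r)) (leg 1 2 P + leg 3 2 P) \<approx> 0"
    using assms(1) inv by (intro invariant_legs) (simp_all add: P_def lie_tensor_coboundary)
  then have "commutator (leg (3::3) 1 r) (leg 3 2 P + leg 1 2 P)
      - (- commutator (leg 1 3 r) (leg 3 2 P + leg 1 2 P)) \<approx> 0"
    by (simp add: leg_hom leg_swap commutator_def algebra_simps)
  then have "commutator (leg (3::3) 1 r) (leg 3 2 P + leg 1 2 P)
      \<approx> - commutator (leg 1 3 r) (leg 3 2 P + leg 1 2 P)"
    unfolding U_eq_diff_iff .
  also have "\<dots> \<approx> - commutator (leg 1 3 r) (- leg 2 3 P + leg 1 2 P)"
    by (intro U_eq_uminus U_eq_commutator U_eq_add U_eq_refl skew) simp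
  finally have s2': "swap 2 3 (swap 1 2 t') \<approx> - commutator (leg 1 3 r) (- leg 2 3 P + leg 1 2 P)"
    unfolding s2 .
  have s1': "swap 1 2 (swap 2 3 t') \<approx> commutator (leg 2 3 r) (- leg 1 2 P + - leg 1 3 P)"
    unfolding s1 by (intro U_eq_commutator U_eq_add U_eq_refl skew) simp_all
  have "t + swap 1 2 (swap 2 3 t) + swap 2 3 (swap 1 2 t)
      \<approx> t' + swap 1 2 (swap 2 3 t') + swap 2 3 (swap 1 2 t')"
    by (intro U_eq_add U_eq_swap t)
  also have "\<dots> \<approx> t' + commutator (leg 2 3 r) (- leg 1 2 P + - leg 1 3 P)
       + - commutator (leg 1 3 r) (- leg 2 3 P + leg 1 2 P)"
    by (intro U_eq_add U_eq_refl s1' s2')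
  also have "\<dots> = commutator (yang_baxter r r r) X"
  proof -
    \<comment> \<open>The letter outside the legs \<open>i\<close> and \<open>j\<close> commutes
      with \<open>r\<close> there, so each leg of \<open>P\<close> is a commutator with the full
      \<open>X\<close>. The claim is then the derivation rule for \<open>X\<close>.\<close>
    have comm: "commutator (leg i j r) (slot k (letter x)) = 0" if "k \<noteq> i" "k \<noteq> j" for i j k :: 3
      using that by (simp add: commutator_def leg_slot_commute)
    have "leg 1 2 P = commutator (leg 1 2 r) X" "leg 1 3 P = commutator (leg 1 3 r) X"
      "leg 2 3 P = commutator (leg 2 3 r) X"
      by (simp_all add: P_def coboundary_def X_def leg_hom leg_comult commutator_simps comm)
    then show ?thesis
      by (simp only: t'_def yang_baxter_def) (simp add: commutator_def algebra_simps)
  qed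
  also have "\<dots> \<approx> commutator 0 X"
    using cybe by (intro U_eq_commutator U_eq_refl) (simp add: CYBE_yang_baxter)
  also have "\<dots> = 0" by (simp add: commutator_simps)
  finally show ?thesis .
qed

text \<open>The cocycle condition is the Jacobi identity for commutators, skewness is invariance of
  the symmetric part, and co-Jacobi also uses the CYBE.\<close>

lemma lie_cobracket_coboundary:
  assumes "lie_tensor r" "CYBE scale bracket r" and inv: "invariant (r + swap 1 2 r)"
  shows "lie_cobracket scale bracket (coboundary r)"
  unfolding lie_cobracket_def Let_def
proof (intro conjI allI impI)
  show "lie_tensor (coboundary r x)" for x using assms lie_tensor_coboundary by blast
  show "coboundary r (x + y) \<approx> coboundary r x + coboundary r y" for x y
    using U_eq_commutator[OF U_eq_refl comult_add, of r x y] by (simp add: coboundary_def commutator_simps)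
  show "coboundary r (scale a x) \<approx> scalar a * coboundary r x" for a x
  proof -
    have "commutator r (scalar a * comult x) = scalar a * commutator r (comult x)"
      by (simp add: commutator_mult_right) (simp add: commutator_def scalar_commute)
    then show ?thesis
      using U_eq_commutator[OF U_eq_refl comult_scale, of r a x] by (simp add: coboundary_def)
  qed
  show "coboundary r (bracket x y) \<approx>
      commutator (coboundary r x) (comult y) - commutator (coboundary r y) (comult x)" for x y
    using U_eq_commutator[OF U_eq_refl comult_bracket, of r x y]
    by (simp add: coboundary_def commutator_jacobi)
  show "swap 1 2 (coboundary r x) \<approx> - coboundary r x" for x
  proof -
    have "swap 1 2 (coboundary r x) - (- coboundary r x) \<approx> 0"
      using inv by (simp add: invariant_def coboundary_hom coboundary_swap add.commute)
    then show ?thesis unfolding U_eq_diff_iff .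
  qed
qed (rule coboundary_co_jacobi[OF assms])

lemma quasi_triangular_coboundary:
  assumes "lie_tensor r" "CYBE scale bracket r" "invariant (r + swap 1 2 r)"
  shows "quasi_triangular scale bracket (coboundary r) r"
  using assms lie_cobracket_coboundary lie_algebra_axioms
  by (simp add: quasi_triangular_def lie_bialgebra_def)

end

section \<open>Direct sums\<close>

definition summand :: "'n \<Rightarrow> 'a::zero \<Rightarrow> 'n \<Rightarrow> 'a" where
  "summand i x = (\<lambda>_. 0)(i := x)"

lemma summand_word_eq: "summand_word i = map_word (summand i)"
  unfolding summand_word_def summand_def ..

abbreviation embed_word :: "('i \<Rightarrow> 'n) \<Rightarrow> ('i \<Rightarrow> 'a::zero word) \<Rightarrow> 'i \<Rightarrow> ('n \<Rightarrow> 'a) word" where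
  "embed_word \<sigma> \<equiv> (\<lambda>w k. summand_word (\<sigma> k) (w k))"

text \<open>Positions stay fixed and the letters at \<open>k\<close> enter the summand
  \<open>\<sigma> k\<close>. With \<open>pair a b\<close> this is the inclusion of the tensor square
  as the component at the summands \<open>a\<close> and \<open>b\<close>.\<close>

definition embed_tensor :: "('i \<Rightarrow> 'n) \<Rightarrow> ('i, 'a::zero, 'k::comm_monoid_add) free_tensor \<Rightarrow> ('i, 'n \<Rightarrow> 'a, 'k) free_tensor" where
  "embed_tensor \<sigma> = linear_ext (embed_word \<sigma>)"

lemma embed_word_add: "embed_word \<sigma> (u + v) = embed_word \<sigma> u + embed_word \<sigma> v"
  by (simp add: fun_eq_iff summand_word_eq map_word_add)

lemma embed_word_at: "embed_word \<sigma> (at_pos i w) = at_pos i (summand_word (\<sigma> i) w)"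
  by (auto simp: fun_eq_iff at_pos_def summand_word_eq)

lemma embed_hom:
  fixes p q :: "('i, 'a::zero, 'k::comm_ring_1) free_tensor"
  shows "embed_tensor \<sigma> (p + q) = embed_tensor \<sigma> p + embed_tensor \<sigma> q" "embed_tensor \<sigma> (- p) = - embed_tensor \<sigma> p"
    "embed_tensor \<sigma> (p * q) = embed_tensor \<sigma> p * embed_tensor \<sigma> q"
    "embed_tensor \<sigma> (commutator p q) = commutator (embed_tensor \<sigma> p) (embed_tensor \<sigma> q)"
    "embed_tensor \<sigma> (0 :: ('i, 'a, 'k) free_tensor) = 0"
  by (simp_all add: embed_tensor_def linear_ext_add linear_ext_uminus linear_ext_mult[of "embed_word \<sigma>", OF embed_word_add]
     commutator_linear_ext[of "embed_word \<sigma>", OF embed_word_add])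

lemma embed_slot:
  "embed_tensor \<sigma> (slot i (letter x)) = slot i (letter (summand (\<sigma> i) x))"
  unfolding embed_tensor_def slot_letter linear_ext_single embed_word_at
  by (simp add: summand_word_eq)

definition pair :: "'n \<Rightarrow> 'n \<Rightarrow> 2 \<Rightarrow> 'n" where
  "pair a b k = (if k = 1 then a else b)"

definition triple :: "'n \<Rightarrow> 'n \<Rightarrow> 'n \<Rightarrow> 3 \<Rightarrow> 'n" where
  "triple a b c k = (if k = 1 then a else if k = 2 then b else c)"

lemma pair_triple_simps [simp]:
  "pair a b 1 = a" "pair a b 2 = b" "triple a b c 1 = a" "triple a b c 2 = b" "triple a b c 3 = c"
  by (simp_all add: pair_def triple_def)

text \<open>Positions off the legs carry the empty word, which every summand map fixes.\<close>

lemma leg_embed: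
  assumes "i \<noteq> j"
  shows "leg i j (embed_tensor (pair (\<sigma> i) (\<sigma> j)) p) = embed_tensor \<sigma> (leg i j p)"
  unfolding leg_def embed_tensor_def linear_ext_comp
  by (rule arg_cong[where f = "\<lambda>f. linear_ext f p"]) (use assms in \<open>auto simp: fun_eq_iff summand_word_eq\<close>)

lemma leg_embed_triple:
  "leg 1 2 (embed_tensor (pair a b) p) = embed_tensor (triple a b c) (leg 1 2 p)"
  "leg 1 3 (embed_tensor (pair a c) p) = embed_tensor (triple a b c) (leg 1 3 p)"
  "leg 2 3 (embed_tensor (pair b c) p) = embed_tensor (triple a b c) (leg 2 3 p)"
  using leg_embed[of 1 2 "triple a b c" p] leg_embed[of 1 3 "triple a b c" p]
    leg_embed[of 2 3 "triple a b c" p] by simp_all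

lemma swap_embed_pair: "swap 1 2 (embed_tensor (pair a b) p) = embed_tensor (pair b a) (swap 1 2 p)"
proof -
  have "pair a b (Transposition.transpose 1 2 k) = pair b a k" for k :: 2
    using exhaust_index2[of k] by auto
  then show ?thesis
    unfolding swap_def embed_tensor_def linear_ext_comp by (simp only:)
qed

lemma embed_tensor_sum:
  "embed_tensor (pair a b) (tensor_sum ts) = tensor_sum (map (\<lambda>(p, q). (summand a p, summand b q)) ts)"
  by (induct ts) (auto simp: tensor_sum_def embed_hom embed_slot)

section \<open>The array r-matrix as a sum of components\<close>

lemma sum_list_if_eq:
  fixes f :: "'b \<Rightarrow> 'm::monoid_add"
  shows "distinct xs \<Longrightarrow> (\<Sum>x\<leftarrow>xs. if x = a then f x else 0) = (if a \<in> set xs then f a else 0)"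
proof (induct xs)
  case (Cons x xs)
  then show ?case by (cases "x = a") auto
qed simp

text \<open>All other words are empty, so the ordered product has a single factor and the order
  plays no part.\<close>

lemma merge_words_at_pos: "merge_words (at_pos a w) = summand_word a w"
proof -
  have "merge_words (at_pos a w) =
      (\<Sum>i\<leftarrow>sorted_list_of_set UNIV. if i = a then summand_word i w else 0)"
    unfolding merge_words_def by (rule arg_cong[where f = sum_list], rule map_cong)
      (auto simp: at_pos_def summand_word_eq)
  then show ?thesis by (simp add: sum_list_if_eq)
qed

text \<open>Each half has at most one nonempty position, so merging places one word in one
  summand.\<close>

lemma identify_leg_Inl_Inr:
  fixes a b :: "'n::{finite,linorder}" and p :: "(2, 'a::zero, 'k::comm_monoid_add) free_tensor"
  shows "identify (leg (Inl a) (Inr b) p) = embed_tensor (pair a b) p"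
proof -
  have "leg_word (Inl a) (Inr b) w \<circ> Inl = at_pos a (w 1)"
    "leg_word (Inl a) (Inr b) w \<circ> Inr = at_pos b (w 2)" for w :: "2 \<Rightarrow> 'a word"
    by (auto simp: at_pos_def fun_eq_iff)
  then have "(if k = 1 then merge_words (leg_word (Inl a) (Inr b) w \<circ> Inl)
      else merge_words (leg_word (Inl a) (Inr b) w \<circ> Inr)) = embed_word (pair a b) w k"
    for w :: "2 \<Rightarrow> 'a word" and k
    using exhaust_index2[of k] by (auto simp: merge_words_at_pos)
  then show ?thesis
    unfolding identify_def leg_def embed_tensor_def linear_ext_comp by (simp only:)
qed

lemma identify_leg_Inr_Inl: "identify (leg (Inr b) (Inl a) p) = embed_tensor (pair a b) (swap 1 2 p)"
  by (simp flip: identify_leg_Inl_Inr add: leg_swap)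

text \<open>The component at the summands \<open>a\<close> and \<open>b\<close>. For
  \<open>i < j\<close> the added leg lies in the component \<open>j\<close>, \<open>i\<close>; the
  subtracted one has its first factor in the second half and hence lies, transposed, in the
  component \<open>i\<close>, \<open>j\<close>.\<close>

definition array_entry ::
    "('c \<Rightarrow> (2, 'a, 'k::field) free_tensor) \<Rightarrow> ('n::linorder \<Rightarrow> 'n \<Rightarrow> 'c) \<Rightarrow> ('n \<Rightarrow> 'c) \<Rightarrow> 'n \<Rightarrow> 'n \<Rightarrow>
      (2, 'a, 'k) free_tensor" where
  "array_entry r c d a b =
     (if a = b then r (d a) else if b < a then r (c b a) else - swap 1 2 (r (c a b)))"

text \<open>Brings a condition out to the sum over its own index, where the delta rule evaluates
  it.\<close>

lemma sum_if_outer: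
  "(\<Sum>x\<in>A. \<Sum>y\<in>B. if P x then F x y else 0) = (\<Sum>x\<in>A. if P x then \<Sum>y\<in>B. F x y else 0)"
  by (intro sum.cong refl) simp

text \<open>The pairs below the diagonal are reflected, to match the index set of
  \<open>array_r_matrix\<close>.\<close>

lemma sum_linorder_split:
  fixes F :: "'n::{finite,linorder} \<Rightarrow> 'n \<Rightarrow> 'm::comm_monoid_add"
  shows "(\<Sum>a\<in>UNIV. \<Sum>b\<in>UNIV. F a b) = (\<Sum>a\<in>UNIV. F a a) + (\<Sum>(a, b)\<in>{(a, b). a < b}. F b a + F a b)"
proof -
  have "(\<Sum>a\<in>UNIV. \<Sum>b\<in>UNIV. F a b) = (\<Sum>(a, b)\<in>UNIV. F a b)"
    by (simp add: sum.cartesian_product)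
  also have "UNIV = range (\<lambda>a::'n. (a, a)) \<union> ({(a, b). b < a} \<union> {(a, b). a < b})"
    by auto
  also have "(\<Sum>(a, b)\<in>\<dots>. F a b) =
      (\<Sum>(a, b)\<in>range (\<lambda>a. (a, a)). F a b) + ((\<Sum>(a, b)\<in>{(a, b). b < a}. F a b) + (\<Sum>(a, b)\<in>{(a, b). a < b}. F a b))"
    by (subst sum.union_disjoint, simp, simp, blast, subst sum.union_disjoint) auto
  also have "(\<Sum>(a, b)\<in>range (\<lambda>a. (a, a)). F a b) = (\<Sum>a\<in>UNIV. F a a)"
    by (subst sum.reindex) (auto simp: inj_on_def)
  also have "(\<Sum>(a, b)\<in>{(a, b). b < a}. F a b) = (\<Sum>(a, b)\<in>{(a, b). a < b}. F b a)"
    by (rule sum.reindex_bij_witness[of _ "\<lambda>(a, b). (b, a)" "\<lambda>(a, b). (b, a)"]) auto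
  finally show ?thesis by (simp add: sum.distrib case_prod_unfold)
qed

lemma identify_hom:
  fixes p q :: "('n::{finite,linorder} + 'n, 'a::zero, 'k::comm_ring_1) free_tensor"
  shows "identify (p + q) = identify p + identify q" "identify (p - q) = identify p - identify q"
    "identify (sum f X) = (\<Sum>x\<in>X. identify (f x :: ('n + 'n, 'a, 'k) free_tensor))"
  by (simp_all add: identify_def linear_ext_add linear_ext_diff linear_ext_sum)

lemma array_r_matrix_eq:
  "array_r_matrix r c d = (\<Sum>a\<in>UNIV. \<Sum>b\<in>UNIV. embed_tensor (pair a b) (array_entry r c d a b))"
proof -
  have "(\<Sum>(i, j)\<in>{(i, j). i < j}.
        embed_tensor (pair j i) (r (c i j)) - embed_tensor (pair i j) (swap 1 2 (r (c i j)))) =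
      (\<Sum>(i, j)\<in>{(i, j). i < j}.
        embed_tensor (pair j i) (array_entry r c d j i) + embed_tensor (pair i j) (array_entry r c d i j))"
    by (rule sum.cong) (auto simp: array_entry_def embed_hom)
  then show ?thesis
    unfolding array_r_matrix_def sum_linorder_split
    by (simp add: identify_hom identify_leg_Inl_Inr identify_leg_Inr_Inl case_prod_unfold)
      (simp add: array_entry_def)
qed

lemma array_entry_skew: "i \<noteq> j \<Longrightarrow> array_entry r c d j i = - swap 1 2 (array_entry r c d i j)"
  by (auto simp: array_entry_def swap_hom)

text \<open>For distinct indices, transitivity of the sorted triple gives one coincidence in each of
  the six orders. If \<open>i = j\<close> or \<open>j = k\<close> two entries agree trivially, and
  \<open>i = k\<close> is the skewness of off-diagonal entries.\<close>

lemma array_entry_cases: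
  fixes r :: "'c \<Rightarrow> (2, 'a, 'k::field) free_tensor" and d :: "'n::linorder \<Rightarrow> 'c"
  assumes "transitive_array c"
  defines "R \<equiv> array_entry r c d"
  shows "R i j = R i k \<or> R i k = R j k \<or> R j k = - swap 1 2 (R i j)"
proof -
  have tr: "c x z = c x y \<or> c x z = c y z" if "x < y" "y < z" for x y z
    using assms(1) that unfolding transitive_array_def by blast
  consider "i = j" | "j = k" | "i = k" "i \<noteq> j" | "i < j" "j < k" | "i < k" "k < j" | "j < i" "i < k"
    | "j < k" "k < i" | "k < i" "i < j" | "k < j" "j < i"
    by (metis linorder_less_linear)
  then show ?thesis
  proof cases
    case 3
    then show ?thesis unfolding R_def using array_entry_skew[of i j r c d] by blast
  qed (use tr[of i j k] tr[of i k j] tr[of j i k] tr[of j k i] tr[of k i j] tr[of k j i]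
      in \<open>auto simp: R_def array_entry_def swap_hom\<close>)
qed

section \<open>Tensors embedded in a direct sum\<close>

context lie_algebra
begin

lemma lie_algebra_sum: "lie_algebra (sum_scale scale) (sum_bracket bracket)"
  by unfold_locales
    (simp_all add: fun_eq_iff sum_scale_def sum_bracket_def scale_right_distrib scale_left_distrib
      bracket_add_left bracket_add_right bracket_scale_left bracket_scale_right bracket_self jacobi)

lemma lie_hom_summand: "lie_hom scale bracket (sum_scale scale) (sum_bracket bracket) (summand a)"
  by (simp add: lie_hom_def summand_def sum_scale_def sum_bracket_def fun_eq_iff)

interpretation L: lie_algebra "sum_scale scale" "sum_bracket bracket"
  by (rule lie_algebra_sum)

lemma U_eq_embed:
  assumes "p \<approx> q" shows "L.eqv (embed_tensor \<sigma> p) (embed_tensor \<sigma> q)"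
  unfolding embed_tensor_def
proof (rule U_eq_linear_ext[of "embed_word \<sigma>", OF embed_word_add _ assms])
  show "\<exists>j h. lie_hom scale bracket (sum_scale scale) (sum_bracket bracket) h \<and>
      (\<forall>w. embed_word \<sigma> (at_pos i w) = at_pos j (map_word h w))" for i
    by (intro exI[of _ i] exI[of _ "summand (\<sigma> i)"] conjI lie_hom_summand)
      (simp only: embed_word_at, simp add: summand_word_eq)
qed

lemma lie_tensor_embed:
  assumes "lie_tensor p" shows "L.lie_tensor (embed_tensor (pair a b) p)"
proof -
  obtain ts where "p \<approx> tensor_sum ts" using assms by (auto simp: in_lie_tensor_def)
  then show ?thesis
    using U_eq_embed embed_tensor_sum L.lie_tensor_cong L.lie_tensor_tensor_sum by metis
qed

lemma bracket_summand: "a \<noteq> b \<Longrightarrow> sum_bracket bracket (summand a x) (summand b y) = 0"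
  by (auto simp: sum_bracket_def summand_def fun_eq_iff)

text \<open>Distinct positions commute, and at a shared position the letters lie in different
  summands; the four conditions list the possible shared positions.\<close>

lemma embed_commute:
  assumes "lie_tensor A" "lie_tensor B" and ne: "i \<noteq> j" "k \<noteq> l"
    and "i = k \<Longrightarrow> a \<noteq> a'" "i = l \<Longrightarrow> a \<noteq> b'" "j = k \<Longrightarrow> b \<noteq> a'" "j = l \<Longrightarrow> b \<noteq> b'"
  shows "L.eqv (commutator (leg i j (embed_tensor (pair a b) A)) (leg k l (embed_tensor (pair a' b') B))) 0"
proof -
  obtain ts us where ts: "A \<approx> tensor_sum ts" and us: "B \<approx> tensor_sum us"
    using assms(1,2) by (auto simp: in_lie_tensor_def)
  have pure: "L.eqv (commutator (slot i (letter (summand a x)) * slot j (letter (summand b y)))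
      (slot k (letter (summand a' x')) * slot l (letter (summand b' y')))) 0" for x y x' y'
    by (intro L.commutator_mult_zero L.commutator_slots_zero bracket_summand) (use assms in auto)
  have "L.eqv (commutator (leg i j (embed_tensor (pair a b) A)) (leg k l (embed_tensor (pair a' b') B)))
      (commutator (leg i j (embed_tensor (pair a b) (tensor_sum ts))) (leg k l (embed_tensor (pair a' b') (tensor_sum us))))"
    by (intro U_eq_commutator U_eq_leg ne U_eq_embed ts us)
  also have "L.eqv \<dots> 0"
    unfolding embed_tensor_sum leg_tensor_sum[OF ne(1)] leg_tensor_sum[OF ne(2)]
      commutator_sum_list_left commutator_sum_list_right
    by (intro L.sum_list_zero) (auto simp: pure)
  finally show ?thesis .
qed

text \<open>\<open>x\<close> splits into its part in the summand \<open>a\<close>, where invariance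
  of \<open>p\<close> applies, and the part \<open>?y\<close> vanishing at \<open>a\<close>, which
  commutes with all letters of that summand.\<close>

lemma invariant_embed:
  fixes a :: 'n
  assumes "invariant p" "lie_tensor p"
  shows "L.invariant (embed_tensor (pair a a) p)"
  unfolding L.invariant_def
proof
  fix x :: "'n \<Rightarrow> 'a"
  obtain ts where ts: "p \<approx> tensor_sum ts" using assms(2) by (auto simp: in_lie_tensor_def)
  let ?y = "x(a := 0)"
  have x: "x = summand a (x a) + ?y" by (auto simp: summand_def fun_eq_iff)
  have "L.eqv (coboundary (embed_tensor (pair a a) p) x) (commutator (embed_tensor (pair a a) p) (comult (summand a (x a)) + comult ?y))"
    unfolding coboundary_def by (subst x) (intro U_eq_commutator U_eq_refl L.comult_add)
  also have "\<dots> = embed_tensor (pair a a) (coboundary p (x a)) + commutator (embed_tensor (pair a a) p) (comult ?y)"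
    by (simp add: coboundary_def comult_def embed_hom embed_slot commutator_simps)
  also have "L.eqv \<dots> (embed_tensor (pair a a) 0 + commutator (tensor_sum (map (\<lambda>(p, q). (summand a p, summand a q)) ts)) (comult ?y))"
    unfolding embed_tensor_sum[symmetric] using assms(1)
    by (intro U_eq_add U_eq_embed U_eq_commutator U_eq_refl ts) (simp add: invariant_def)
  also have "L.eqv \<dots> (0 + 0)"
  proof (intro U_eq_add)
    have y: "sum_bracket bracket (summand a p) ?y = 0" for p
      by (auto simp: sum_bracket_def summand_def fun_eq_iff)
    have "L.eqv (commutator (slot i (letter (summand a p))) (comult ?y)) (0 + 0)" for i :: 2 and p
      unfolding comult_def commutator_simps by (intro U_eq_add L.commutator_slots_zero y)
    then show "L.eqv (commutator (tensor_sum (map (\<lambda>(p, q). (summand a p, summand a q)) ts)) (comult ?y)) 0"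
      unfolding tensor_sum_def commutator_sum_list_left
      by (intro L.sum_list_zero) (auto intro!: L.commutator_mult_zero)
  qed (simp add: embed_hom)
  finally show "L.eqv (coboundary (embed_tensor (pair a a) p) x) 0" by simp
qed

lemma CYBE_sum_embed:
  fixes R :: "'n::finite \<Rightarrow> 'n \<Rightarrow> (2, 'a, 'k) free_tensor"
  assumes lie: "\<And>a b. lie_tensor (R a b)"
    and yb: "\<And>a b c. yang_baxter (R a b) (R a c) (R b c) \<approx> 0"
  shows "CYBE (sum_scale scale) (sum_bracket bracket) (\<Sum>a\<in>UNIV. \<Sum>b\<in>UNIV. embed_tensor (pair a b) (R a b))"
    (is "CYBE _ _ ?R")
proof -
  define E where "E a b = embed_tensor (pair a b) (R a b)" for a b
  define X :: "'n \<Rightarrow> 'n \<Rightarrow> (3, 'n \<Rightarrow> 'a, 'k) free_tensor" where "X a b = leg 1 2 (E a b)" for a b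
  define Y :: "'n \<Rightarrow> 'n \<Rightarrow> (3, 'n \<Rightarrow> 'a, 'k) free_tensor" where "Y a b = leg 1 3 (E a b)" for a b
  define Z :: "'n \<Rightarrow> 'n \<Rightarrow> (3, 'n \<Rightarrow> 'a, 'k) free_tensor" where "Z a b = leg 2 3 (E a b)" for a b
  have legs: "leg 1 2 ?R = (\<Sum>a\<in>UNIV. \<Sum>b\<in>UNIV. X a b)" "leg 1 3 ?R = (\<Sum>a\<in>UNIV. \<Sum>b\<in>UNIV. Y a b)"
    "leg 2 3 ?R = (\<Sum>a\<in>UNIV. \<Sum>b\<in>UNIV. Z a b)"
    by (simp_all add: X_def Y_def Z_def E_def leg_hom)
  \<comment> \<open>Two legs share exactly one position: 1, 2 or 3 respectively. Unless their
    summands agree there, the commutator vanishes.\<close>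
  have XY: "L.eqv (commutator (X a b) (Y a' c)) (if a = a' then commutator (X a b) (Y a c) else 0)"
    and XZ: "L.eqv (commutator (X a b) (Z b' c)) (if b = b' then commutator (X a b) (Z b c) else 0)"
    and YZ: "L.eqv (commutator (Y a c) (Z b c')) (if c = c' then commutator (Y a c) (Z b c) else 0)"
    for a b c a' b' c'
    unfolding X_def Y_def Z_def E_def by (auto intro!: embed_commute lie)
  have "L.eqv (commutator (leg 1 2 ?R) (leg 1 3 ?R))
      (\<Sum>a\<in>UNIV. \<Sum>b\<in>UNIV. \<Sum>a'\<in>UNIV. \<Sum>c\<in>UNIV. if a = a' then commutator (X a b) (Y a c) else 0)"
    unfolding legs commutator_sum_left unfolding commutator_sum_right by (intro U_eq_sum XY)
  also have "\<dots> = (\<Sum>a\<in>UNIV. \<Sum>b\<in>UNIV. \<Sum>c\<in>UNIV. commutator (X a b) (Y a c))"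
    by (simp add: sum_if_outer)
  finally have XY': "L.eqv (commutator (leg 1 2 ?R) (leg 1 3 ?R)) \<dots>" .
  have "L.eqv (commutator (leg 1 2 ?R) (leg 2 3 ?R))
      (\<Sum>a\<in>UNIV. \<Sum>b\<in>UNIV. \<Sum>b'\<in>UNIV. \<Sum>c\<in>UNIV. if b = b' then commutator (X a b) (Z b c) else 0)"
    unfolding legs commutator_sum_left unfolding commutator_sum_right by (intro U_eq_sum XZ)
  also have "\<dots> = (\<Sum>a\<in>UNIV. \<Sum>b\<in>UNIV. \<Sum>c\<in>UNIV. commutator (X a b) (Z b c))"
    by (simp add: sum_if_outer)
  finally have XZ': "L.eqv (commutator (leg 1 2 ?R) (leg 2 3 ?R)) \<dots>" .
  have "L.eqv (commutator (leg 1 3 ?R) (leg 2 3 ?R))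
      (\<Sum>a\<in>UNIV. \<Sum>c\<in>UNIV. \<Sum>b\<in>UNIV. \<Sum>c'\<in>UNIV. if c = c' then commutator (Y a c) (Z b c) else 0)"
    unfolding legs commutator_sum_left unfolding commutator_sum_right by (intro U_eq_sum YZ)
  also have "\<dots> = (\<Sum>a\<in>UNIV. \<Sum>c\<in>UNIV. \<Sum>b\<in>UNIV. commutator (Y a c) (Z b c))"
    by simp
  also have "\<dots> = (\<Sum>a\<in>UNIV. \<Sum>b\<in>UNIV. \<Sum>c\<in>UNIV. commutator (Y a c) (Z b c))"
    by (rule sum.cong[OF refl], rule sum.swap)
  finally have YZ': "L.eqv (commutator (leg 1 3 ?R) (leg 2 3 ?R)) \<dots>" .
  \<comment> \<open>The surviving terms at the summands \<open>a\<close>, \<open>b\<close>,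
    \<open>c\<close> form the embedded Yang-Baxter expression.\<close>
  have total: "commutator (X a b) (Y a c) + commutator (X a b) (Z b c) + commutator (Y a c) (Z b c) =
      embed_tensor (triple a b c) (yang_baxter (R a b) (R a c) (R b c))" for a b c
    unfolding X_def Y_def Z_def E_def yang_baxter_def embed_hom
      leg_embed_triple(1)[of a b _ c] leg_embed_triple(2)[of a c _ b] leg_embed_triple(3)[of b c _ a] ..
  have "L.eqv (yang_baxter ?R ?R ?R)
     ((\<Sum>a\<in>UNIV. \<Sum>b\<in>UNIV. \<Sum>c\<in>UNIV. commutator (X a b) (Y a c))
      + (\<Sum>a\<in>UNIV. \<Sum>b\<in>UNIV. \<Sum>c\<in>UNIV. commutator (X a b) (Z b c))
      + (\<Sum>a\<in>UNIV. \<Sum>b\<in>UNIV. \<Sum>c\<in>UNIV. commutator (Y a c) (Z b c)))"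
    unfolding yang_baxter_def by (intro U_eq_add XY' XZ' YZ')
  also have "\<dots> = (\<Sum>a\<in>UNIV. \<Sum>b\<in>UNIV. \<Sum>c\<in>UNIV. commutator (X a b) (Y a c)
      + commutator (X a b) (Z b c) + commutator (Y a c) (Z b c))"
    by (simp add: sum.distrib)
  also have "\<dots> = (\<Sum>a\<in>UNIV. \<Sum>b\<in>UNIV. \<Sum>c\<in>UNIV. embed_tensor (triple a b c) (yang_baxter (R a b) (R a c) (R b c)))"
    by (simp only: total)
  also have "L.eqv \<dots> (\<Sum>a\<in>UNIV. \<Sum>b\<in>UNIV. \<Sum>c\<in>UNIV. embed_tensor (triple a b c) 0)"
    by (intro U_eq_sum U_eq_embed yb)
  also have "\<dots> = 0" by (simp add: embed_hom)
  finally show ?thesis unfolding CYBE_yang_baxter .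
qed

lemma invariant_sum_embed:
  fixes R :: "'n::finite \<Rightarrow> 'n \<Rightarrow> (2, 'a, 'k) free_tensor"
  assumes lie: "\<And>a. lie_tensor (R a a)" and inv: "\<And>a. invariant (R a a + swap 1 2 (R a a))"
    and skew: "\<And>a b. a \<noteq> b \<Longrightarrow> R b a = - swap 1 2 (R a b)"
  defines "\<rho> \<equiv> (\<Sum>a\<in>UNIV. \<Sum>b\<in>UNIV. embed_tensor (pair a b) (R a b))"
  shows "L.invariant (\<rho> + swap 1 2 \<rho>)"
proof -
  \<comment> \<open>Off the diagonal the entries are negated transposes of each other and cancel,
    leaving a sum of embedded invariants.\<close>
  have cancel: "embed_tensor (pair a b) (R a b + swap 1 2 (R b a)) =
      (if a = b then embed_tensor (pair a a) (R a a + swap 1 2 (R a a)) else 0)" for a b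
    using skew[of b a] by (cases "a = b") (simp_all add: embed_hom)
  have "swap 1 2 \<rho> = (\<Sum>a\<in>UNIV. \<Sum>b\<in>UNIV. embed_tensor (pair a b) (swap 1 2 (R b a)))"
    unfolding \<rho>_def swap_hom swap_embed_pair by (rule sum.swap)
  then have "\<rho> + swap 1 2 \<rho> = (\<Sum>a\<in>UNIV. \<Sum>b\<in>UNIV. embed_tensor (pair a b) (R a b + swap 1 2 (R b a)))"
    by (simp add: \<rho>_def sum.distrib embed_hom)
  also have "\<dots> = (\<Sum>a\<in>UNIV. \<Sum>b\<in>UNIV. if a = b then embed_tensor (pair a a) (R a a + swap 1 2 (R a a)) else 0)"
    by (intro sum.cong refl cancel)
  also have "\<dots> = (\<Sum>a\<in>UNIV. embed_tensor (pair a a) (R a a + swap 1 2 (R a a)))"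
    by simp
  finally show ?thesis
    using lie inv by (auto intro!: L.invariant_sum invariant_embed lie_tensor_add lie_tensor_swap)
qed

lemma quasi_triangular_sum_embed:
  fixes R :: "'n::finite \<Rightarrow> 'n \<Rightarrow> (2, 'a, 'k) free_tensor"
  assumes R: "\<And>a b. r_matrix \<delta> (R a b)" and \<delta>: "\<And>x. swap 1 2 (\<delta> x) \<approx> - \<delta> x"
    and skew: "\<And>a b. a \<noteq> b \<Longrightarrow> R b a = - swap 1 2 (R a b)"
    and tr: "\<And>a b c. R a b = R a c \<or> R a c = R b c \<or> R b c = - swap 1 2 (R a b)"
  defines "\<rho> \<equiv> (\<Sum>a\<in>UNIV. \<Sum>b\<in>UNIV. embed_tensor (pair a b) (R a b))"
  shows "quasi_triangular (sum_scale scale) (sum_bracket bracket) (coboundary \<rho>) \<rho>"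
proof (rule L.quasi_triangular_coboundary)
  have lie: "lie_tensor (R a b)" for a b using R by (simp add: r_matrix_def)
  show "L.lie_tensor \<rho>"
    unfolding \<rho>_def by (intro L.lie_tensor_sum lie_tensor_embed lie)
  show "CYBE (sum_scale scale) (sum_bracket bracket) \<rho>"
    unfolding \<rho>_def by (intro CYBE_sum_embed lie yang_baxter_r_matrix[OF R R R] tr)
  \<comment> \<open>A diagonal entry and its negated transpose are r-matrices of the same cobracket;
    their difference is the symmetric part.\<close>
  have "invariant (R a a + swap 1 2 (R a a))" for a
    using invariant_diff_r_matrix[OF R[of a a] r_matrix_uminus_swap[OF R[of a a] \<delta>]] by simp
  then show "L.invariant (\<rho> + swap 1 2 \<rho>)"
    unfolding \<rho>_def by (intro invariant_sum_embed lie skew)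
qed

end

theorem theorem1p3:
  fixes scale :: "'k::field_char_0 \<Rightarrow> 'a::ab_group_add \<Rightarrow> 'a"
    and bracket :: "'a \<Rightarrow> 'a \<Rightarrow> 'a"
    and \<delta> :: "'a \<Rightarrow> (2, 'a, 'k) free_tensor"
    and C :: "'c set"
    and r :: "'c \<Rightarrow> (2, 'a, 'k) free_tensor"
    and d :: "'n::{finite,linorder} \<Rightarrow> 'c"
    and c :: "'n \<Rightarrow> 'n \<Rightarrow> 'c"
  assumes "lie_bialgebra scale bracket \<delta>"
    and "\<And>\<gamma>. \<gamma> \<in> C \<Longrightarrow> quasi_triangular scale bracket \<delta> (r \<gamma>)"
    and "\<And>i. d i \<in> C"
    and "\<And>i j. i < j \<Longrightarrow> c i j \<in> C"
    and "transitive_array c"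
  shows "quasi_triangular (sum_scale scale) (sum_bracket bracket)
           (coboundary (array_r_matrix r c d)) (array_r_matrix r c d)"
proof -
  interpret lie_algebra scale bracket using assms(1) by (simp add: lie_bialgebra_def)
  have skew: "swap 1 2 (\<delta> x) \<approx> - \<delta> x" for x
    using assms(1) by (simp add: lie_bialgebra_def lie_cobracket_def)
  have r: "r_matrix \<delta> (r \<gamma>)" if "\<gamma> \<in> C" for \<gamma>
    using assms(2)[OF that] by (simp add: quasi_triangular_def r_matrix_def)
  \<comment> \<open>Entries on and below the diagonal belong to the family; those above are negated
    transposes, covered by skewness of the cobracket.\<close>
  have R: "r_matrix \<delta> (array_entry r c d a b)" for a b
    using assms(3)[of a] assms(4)[of a b] assms(4)[of b a]
    by (auto simp: array_entry_def r r_matrix_uminus_swap skew not_less_iff_gr_or_eq)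
  show ?thesis
    unfolding array_r_matrix_eq
  proof (rule quasi_triangular_sum_embed[OF R skew])
    show "array_entry r c d b a = - swap 1 2 (array_entry r c d a b)" if "a \<noteq> b" for a b
      using that by (rule array_entry_skew)
    show "array_entry r c d a b = array_entry r c d a k \<or> array_entry r c d a k = array_entry r c d b k \<or>
        array_entry r c d b k = - swap 1 2 (array_entry r c d a b)" for a b k
      using assms(5) by (rule array_entry_cases)
  qed
qed

end
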